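(* Under the phase-separation assumption (with parameter $\Delta$) on the secondary voltages of the SVRs, MBOPF is a relaxation of RBOPF. That is: for every feasible point $(s,\mathfrak s,V,I,S,S',r,A)$ of RBOPF satisfying the phase-separation assumption, there exist values of the additional variables $R,U,W,\tilde U,\tilde W,\hat U,\hat W,\tilde{\mathfrak U},\tilde\Psi,\hat{\mathfrak U},\hat\Psi,X$ such that together with $(s,\mathfrak s,V,I,S,S',r,A)$ they form a feasible point of MBOPF; the objective $c(s_0,\mathfrak s,V,I)$ of both problems is the same. (RBOPF, MBOPF and the phase-separation assumption are defined in the context.)
   Context: **Notation.** $\bar{x}$ denotes the conjugate transpose of a vector or matrix $x$. For a vector $x$, $\mathrm{diag}(x)$ is the diagonal matrix with diagonal $x$; for a square matrix $X$, $\mathrm{diag}(X)$ is the vector of its diagonal entries. Inequalities between vectors or real matrices are entrywise. $\succeq$ is the positive semidefinite order on Hermitian matrices. Vectors and matrices are indexed by the phases $\Omega=\{a,b,c\}$. Right shift: $\acute a=b,\acute b=c,\acute c=a$; left shift: $\grave a=c,\grave b=a,\grave c=b$. For real $t$, $t^+=\max(t,0)$, $t^-=\max(-t,0)$. **Network.** $(\mathcal N,\mathcal E)$ is a finite directed graph, $\mathcal N=\{0,\dots,N\}$; write $n\to m$ for $(n,m)\in\mathcal E$. $\mathcal E=\mathcal E_{\mathrm t}\cup\mathcal E_{\mathrm r}$ is a partition into lines/transformers and step-voltage regulators (SVRs), and $\mathcal E_{\mathrm r}=\mathcal E_{\mathrm y}\cup\mathcal E_{\mathrm o}\cup\mathcal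 E_{\mathrm c}$ is a partition into wye, open-delta and closed-delta SVRs. $\mathcal N_m^{\mathrm p}=\{n:(n,m)\in\mathcal E_{\mathrm r}\}$. Data: $Z_{nm}\in\mathbb C^{3\times3}$ ($(n,m)\in\mathcal E_{\mathrm t}$), $Y_m\in\mathbb C^{3\times3}$ ($m\in\mathcal N$), $\mathrm v_0\in\mathbb C^3$, reals $0<v_{\min}\le v_{\max}$, a set $\mathcal S$, a cost function $c$. **SVR gains.** For $(n,m)\in\mathcal E_{\mathrm r}$, with real ratios $r_{nm}=(r^a_{nm},r^b_{nm},r^c_{nm})$, $A_{nm}=\mathrm{diag}(r_{nm})D_{nm}+F_{nm}$ where wye: $D=\mathrm{Id}$, $F=0$; closed-delta: $D=\begin{bmatrix}1&-1&0\\0&1&-1\\-1&0&1\end{bmatrix}$, $F=\begin{bmatrix}0&1&0\\0&0&1\\1&0&0\end{bmatrix}$; open-delta: $D=\begin{bmatrix}1&-1&0\\0&1&0\\0&-1&1\end{bmatrix}$, $F=\begin{bmatrix}0&1&0\\0&0&0\\0&1&0\end{bmatrix}$. Ratio bounds: $r_{\min}^\phi\le r_{nm}^\phi\le r_{\max}^\phi$ with $r_{\min}^\phi=0.9$, $r_{\max}^\phi=1.1$, except that for open-delta SVRs $r_{\min}^b=r_{\max}^b=1$. **RBOPF.** Variables: $s_m,\mathfrak s_m\in\mathbb C^3$ ($m\in\mathcal N$), $r_{nm},A_{nm}$ ($\mathcal E_{\mathrm r}$), complex $3\times 3$ matrices $V_m$ ($\mathcal N$), $I_{nm},S_{nm}$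 ($\mathcal E$), $S'_{nm}$ ($\mathcal E_{\mathrm r}$). Minimize $c(s_0,\mathfrak s,V,I)$ subject to: (R0) $A_{nm}=\mathrm{diag}(r_{nm})D_{nm}+F_{nm}$ and the ratio bounds, $(n,m)\in\mathcal E_{\mathrm r}$; $\mathfrak s\in\mathcal S$; (R1) $V_m=V_n+Z_{nm}I_{nm}\bar Z_{nm}-(S_{nm}\bar Z_{nm}+Z_{nm}\bar S_{nm})$, $(n,m)\in\mathcal E_{\mathrm t}$; (R2) $V_n=A_{nm}V_m\bar A_{nm}$, $(n,m)\in\mathcal E_{\mathrm r}$; (R3) $\mathrm{diag}(A_{nm}^{-1}S_{nm}A_{nm})=\mathrm{diag}(S'_{nm})$, $(n,m)\in\mathcal E_{\mathrm r}$; (R4) $s_m=\mathfrak s_m-\mathrm{diag}(V_m\bar Y_m)$, $m\in\mathcal N$; (R5) $s_m=\sum_{k:m\to k}\mathrm{diag}(S_{mk})-\sum_{n:n\to m,\,n\in\mathcal N_m^{\mathrm p}}\mathrm{diag}(S'_{nm})-\sum_{n:n\to m,\,n\notin\mathcal N_m^{\mathrm p}}\mathrm{diag}(S_{nm}-Z_{nm}I_{nm})$, $m\in\mathcal N$; (R6) $V_0=\mathrm v_0\bar{\mathrm v}_0$; $v_{\min}^2\le\mathrm{diag}(V_n)\le v_{\max}^2$, $n\in\mathcal N$; (R7) $\begin{bmatrix}V_n&S_{nm}\\\bar S_{nm}&I_{nm}\end{bmatrix}\succeq 0$, $(n,m)\in\mathcal E$; (R8) the matrix in (R7) has rank $1$,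 $(n,m)\in\mathcal E$. **Phase-separation assumption.** There is a fixed $\Delta>0$ with $90^\circ\le120^\circ-\Delta$ and $120^\circ+\Delta\le180^\circ$ such that for every SVR secondary bus $m$ (i.e. $(n,m)\in\mathcal E_{\mathrm r}$ for some $n$) with voltage phasor $v_m=(|v_m^\phi|e^{j\theta^\phi})_{\phi\in\Omega}$, $V_m=v_m\bar v_m$, one has $120^\circ-\Delta\le\theta^\phi-\theta^{\acute\phi}\le120^\circ+\Delta$ for all $\phi\in\Omega$, angle differences being taken modulo $360^\circ$. **Bounds.** Define real $3\times3$ matrices: $U_{\min}^{\phi\phi}=v_{\min}^2$, $U_{\max}^{\phi\phi}=v_{\max}^2$, $W_{\min}^{\phi\phi}=W_{\max}^{\phi\phi}=0$; $U_{\min}^{\phi\acute\phi}=U_{\min}^{\acute\phi\phi}=v_{\max}^2\cos(120^\circ+\Delta)$, $U_{\max}^{\phi\acute\phi}=U_{\max}^{\acute\phi\phi}=v_{\min}^2\cos(120^\circ-\Delta)$; $W_{\min}^{\phi\acute\phi}=v_{\min}^2\sin(120^\circ+\Delta)$, $W_{\max}^{\phi\acute\phi}=v_{\max}^2\sin(120^\circ-\Delta)$, $W_{\min}^{\acute\phi\phi}=-W_{\max}^{\phi\acute\phi}$, $W_{\max}^{\acute\phi\phi}=-W_{\min}^{\phi\acute\phi}$ ($\phi\in\Omega$). For each $(n,m)\in\mathcal E_{\mathrm r}$, the bounds $\tilde U_{\min},\tilde U_{\max}$ (on $D_{nm}U\bar D_{nm}$), $\hat U_{\min},\hat U_{\max}$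 (on $D_{nm}U\bar F_{nm}$), $\tilde W_{\min},\tilde W_{\max}$ (on $D_{nm}W\bar D_{nm}$), $\hat W_{\min},\hat W_{\max}$ (on $D_{nm}W\bar F_{nm}$) are obtained entrywise as follows. For $U$ real symmetric, the $(\psi,\psi')$ entry of $D U\bar D$ (resp. $DU\bar F$) is uniquely $\sum_{\phi}\alpha_\phi U^{\phi\phi}+\sum_\phi\beta_\phi U^{\phi\acute\phi}$; its lower bound is $\sum_\phi(\alpha_\phi^+U_{\min}^{\phi\phi}-\alpha_\phi^-U_{\max}^{\phi\phi}+\beta_\phi^+U_{\min}^{\phi\acute\phi}-\beta_\phi^-U_{\max}^{\phi\acute\phi})$, and its upper bound is the same expression with min and max interchanged. For $W$ real antisymmetric, the $(\psi,\psi')$ entry of $DW\bar D$ (resp. $DW\bar F$) is uniquely $\sum_\phi\gamma_\phi W^{\phi\acute\phi}$; its lower bound is $\sum_\phi(\gamma_\phi^+W_{\min}^{\phi\acute\phi}-\gamma_\phi^-W_{\max}^{\phi\acute\phi})$ and its upper bound is the same with min and max interchanged. **McCormick polyhedron.** $\mathcal M(u,w,x;u_{\min},u_{\max},w_{\min},w_{\max})\le0$ abbreviates: $u_{\min}\le u\le u_{\max}$, $w_{\min}\le w\le w_{\max}$, $u_{\min}w+uw_{\min}-u_{\min}w_{\min}\le x$, $u_{\max}w+uw_{\max}-u_{\max}w_{\max}\le x$, $u_{\max}w+uw_{\min}-u_{\max}w_{\min}\ge x$, $u_{\min}w+uw_{\max}-u_{\min}w_{\max}\ge x$. **MBOPF.**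 Variables: those of RBOPF and real $3\times3$ matrices $U_k,W_k$ (for every bus $k$ that is a primary or a secondary of an SVR), $R_{nm},\tilde U_{nm},\tilde W_{nm},\hat U_{nm},\hat W_{nm},\tilde{\mathfrak U}_{nm},\tilde\Psi_{nm},\hat{\mathfrak U}_{nm},\hat\Psi_{nm}$ ($(n,m)\in\mathcal E_{\mathrm r}$), and reals $X_m^{\phi1},\dots,X_m^{\phi9}$ ($\phi\in\Omega$, $m$ an SVR secondary). Minimize $c(s_0,\mathfrak s,V,I)$ subject to (R0), (R1), (R4), (R5), (R6), (R7) and, for all $(n,m)\in\mathcal E_{\mathrm r}$: (M1) $\mathrm{diag}(S_{nm})=\mathrm{diag}(S'_{nm})$ if $(n,m)\in\mathcal E_{\mathrm y}$; $\mathrm{tr}(S_{nm})=\mathrm{tr}(S'_{nm})$ if $(n,m)\in\mathcal E_{\mathrm o}\cup\mathcal E_{\mathrm c}$; (M2) $U_n=\mathrm{Re}\,V_n$, $W_n=\mathrm{Im}\,V_n$, $U_m=\mathrm{Re}\,V_m$, $W_m=\mathrm{Im}\,V_m$; (M3) $\tilde U_{nm}=D_{nm}U_m\bar D_{nm}$, $\tilde W_{nm}=D_{nm}W_m\bar D_{nm}$, $\hat U_{nm}=D_{nm}U_m\bar F_{nm}$, $\hat W_{nm}=D_{nm}W_m\bar F_{nm}$; (M4) $U_n=\tilde{\mathfrak U}_{nm}+\hat{\mathfrak U}_{nm}+\bar{\hat{\mathfrak U}}_{nm}+F_{nm}U_m\bar F_{nm}$, $W_n=\tilde\Psi_{nm}+\hat\Psi_{nm}-\bar{\hat\Psi}_{nm}+F_{nm}W_m\bar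 F_{nm}$; (M5) $U_{\min}\le U_m\le U_{\max}$, $W_{\min}\le W_m\le W_{\max}$, $\tilde U_{\min}\le\tilde U_{nm}\le\tilde U_{\max}$, $\tilde W_{\min}\le\tilde W_{nm}\le\tilde W_{\max}$, $\hat U_{\min}\le\hat U_{nm}\le\hat U_{\max}$, $\hat W_{\min}\le\hat W_{nm}\le\hat W_{\max}$; (M6) $\mathcal M(r_{nm}^\phi,r_{nm}^{\phi'},R_{nm}^{\phi\phi'};r_{\min}^\phi,r_{\max}^\phi,r_{\min}^{\phi'},r_{\max}^{\phi'})\le0$ for $\phi,\phi'\in\Omega$, and $\begin{bmatrix}R_{nm}&r_{nm}\\\bar r_{nm}&1\end{bmatrix}\succeq0$; (M7) for $\phi\in\Omega$, $\phi'\in\{\phi,\acute\phi\}$: $\mathcal M(R_{nm}^{\phi\phi'},\tilde U_{nm}^{\phi\phi'},\tilde{\mathfrak U}_{nm}^{\phi\phi'};r_{\min}^\phi r_{\min}^{\phi'},r_{\max}^\phi r_{\max}^{\phi'},\tilde U_{\min}^{\phi\phi'},\tilde U_{\max}^{\phi\phi'})\le0$ and $\mathcal M(R_{nm}^{\phi\phi'},\tilde W_{nm}^{\phi\phi'},\tilde\Psi_{nm}^{\phi\phi'};r_{\min}^\phi r_{\min}^{\phi'},r_{\max}^\phi r_{\max}^{\phi'},\tilde W_{\min}^{\phi\phi'},\tilde W_{\max}^{\phi\phi'})\le0$; (M8) for $\phi,\phi'\in\Omega$: $\mathcal M(r_{nm}^\phi,\hat U_{nm}^{\phi\phi'},\hat{\mathfrak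 U}_{nm}^{\phi\phi'};r_{\min}^\phi,r_{\max}^\phi,\hat U_{\min}^{\phi\phi'},\hat U_{\max}^{\phi\phi'})\le0$ and $\mathcal M(r_{nm}^\phi,\hat W_{nm}^{\phi\phi'},\hat\Psi_{nm}^{\phi\phi'};r_{\min}^\phi,r_{\max}^\phi,\hat W_{\min}^{\phi\phi'},\hat W_{\max}^{\phi\phi'})\le0$; (M9) for $\phi\in\Omega$: $X_m^{\phi1}-X_m^{\phi2}-X_m^{\phi3}=0$, $X_m^{\phi4}-X_m^{\phi5}-X_m^{\phi6}=0$, $X_m^{\phi7}+X_m^{\phi8}-X_m^{\phi9}=0$; (M10) for $\phi\in\Omega$ and $k=1,\dots,9$: $\mathcal M(p_k,q_k,X_m^{\phi k};\underline p_k,\overline p_k,\underline q_k,\overline q_k)\le0$, where $(p_k,q_k)$ are the entries $k=1$: $(U_m^{\phi\phi},U_m^{\acute\phi\acute\phi})$; $2$: $(U_m^{\phi\acute\phi},U_m^{\phi\acute\phi})$; $3$: $(W_m^{\phi\acute\phi},W_m^{\phi\acute\phi})$; $4$: $(U_m^{\grave\phi\phi},U_m^{\phi\acute\phi})$; $5$: $(W_m^{\grave\phi\phi},W_m^{\phi\acute\phi})$; $6$: $(U_m^{\phi\phi},U_m^{\grave\phi\acute\phi})$; $7$: $(U_m^{\grave\phi\phi},W_m^{\phi\acute\phi})$; $8$: $(U_m^{\phi\acute\phi},W_m^{\grave\phi\phi})$; $9$: $(U_m^{\phi\phi},W_m^{\grave\phi\acute\phi})$, and the bounds are the corresponding entries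 of $U_{\min},U_{\max}$ or $W_{\min},W_{\max}$. *)

theory Defs
  imports "HOL-Analysis.Analysis"
begin

section \<open>Matrices\<close>

text \<open>
  The phases \<open>a, b, c\<close> are the elements \<open>1, 2, 3\<close> of the type \<open>3\<close>. Addition on this type is modulo
  three (so that \<open>3 + 1 = 1\<close>); the right shift of a phase \<open>\<phi>\<close> is thus \<open>\<phi> + 1\<close> and its left shift
  is \<open>\<phi> - 1\<close>.
\<close>

type_synonym cvec3 = "complex^3"
type_synonym cmat3 = "complex^3^3"
type_synonym rvec3 = "real^3"
type_synonym rmat3 = "real^3^3"

definition ctranspose :: "complex^'n^'m \<Rightarrow> complex^'m^'n" where
  "ctranspose M = (\<chi> i j. cnj (M $ j $ i))"

definition outer :: "complex^'n \<Rightarrow> complex^'n^'n" where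
  "outer v = (\<chi> i j. v $ i * cnj (v $ j))"

definition diag_mat :: "'a::zero^'n \<Rightarrow> 'a^'n^'n" where
  "diag_mat v = (\<chi> i j. if i = j then v $ i else 0)"

definition diag_vec :: "'a^'n^'n \<Rightarrow> 'a^'n" where
  "diag_vec M = (\<chi> i. M $ i $ i)"

definition block_mat ::
  "'a^'n^'m \<Rightarrow> 'a^'q^'m \<Rightarrow> 'a^'n^'p \<Rightarrow> 'a^'q^'p \<Rightarrow> 'a^('n + 'q)^('m + 'p)" where
  "block_mat P Q R T = (\<chi> i j.
     case i of
       Inl i' \<Rightarrow> (case j of Inl j' \<Rightarrow> P $ i' $ j' | Inr j' \<Rightarrow> Q $ i' $ j')
     | Inr i' \<Rightarrow> (case j of Inl j' \<Rightarrow> R $ i' $ j' | Inr j' \<Rightarrow> T $ i' $ j'))"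

definition psd :: "complex^'n^'n \<Rightarrow> bool" where
  "psd M \<longleftrightarrow> ctranspose M = M \<and>
     (\<forall>x. 0 \<le> Re (\<Sum>i\<in>UNIV. \<Sum>j\<in>UNIV. cnj (x $ i) * M $ i $ j * x $ j))"

abbreviation cmat :: "real^'n^'m \<Rightarrow> complex^'n^'m" where
  "cmat \<equiv> map_matrix complex_of_real"


section \<open>Network data\<close>

text \<open>
  Families indexed by buses or edges are total functions; only their values on the buses
  \<open>{..net_N G}\<close>, respectively on the relevant edges, enter the constraints. The set \<open>net_Sset\<close> and
  the function \<open>net_cost\<close> are arbitrary.
\<close>

type_synonym edge = "nat \<times> nat"

record network =
  net_N :: nat
  net_Et :: "edge set"
  net_Ey :: "edge set"
  net_Eo :: "edge set"
  net_Ec :: "edge set"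
  net_Z :: "edge \<Rightarrow> cmat3"
  net_Y :: "nat \<Rightarrow> cmat3"
  net_v0 :: cvec3
  net_vmin :: real
  net_vmax :: real
  net_Sset :: "(nat \<Rightarrow> cvec3) set"
  net_cost :: "cvec3 \<Rightarrow> (nat \<Rightarrow> cvec3) \<Rightarrow> (nat \<Rightarrow> cmat3) \<Rightarrow> (edge \<Rightarrow> cmat3) \<Rightarrow> real"

definition net_Er :: "network \<Rightarrow> edge set" where
  "net_Er G = net_Ey G \<union> net_Eo G \<union> net_Ec G"

definition net_E :: "network \<Rightarrow> edge set" where
  "net_E G = net_Et G \<union> net_Er G"

definition wf_network :: "network \<Rightarrow> bool" where
  "wf_network G \<longleftrightarrow>
     net_E G \<subseteq> {..net_N G} \<times> {..net_N G} \<and>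
     net_Et G \<inter> net_Er G = {} \<and>
     net_Ey G \<inter> net_Eo G = {} \<and> net_Ey G \<inter> net_Ec G = {} \<and> net_Eo G \<inter> net_Ec G = {} \<and>
     0 < net_vmin G \<and> net_vmin G \<le> net_vmax G"

definition svr_primaries :: "network \<Rightarrow> nat \<Rightarrow> nat set" where
  "svr_primaries G m = {n. (n, m) \<in> net_Er G}"

text \<open>The last branches of the next two definitions are the open-delta matrices.\<close>

definition svr_D :: "network \<Rightarrow> edge \<Rightarrow> rmat3" where
  "svr_D G e =
     (if e \<in> net_Ey G then mat 1
      else if e \<in> net_Ec G then
        vector [vector [1, -1, 0], vector [0, 1, -1], vector [-1, 0, 1]]
      else
        vector [vector [1, -1, 0], vector [0, 1, 0], vector [0, -1, 1]])"

definition svr_F :: "network \<Rightarrow> edge \<Rightarrow> rmat3" where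
  "svr_F G e =
     (if e \<in> net_Ey G then 0
      else if e \<in> net_Ec G then
        vector [vector [0, 1, 0], vector [0, 0, 1], vector [1, 0, 0]]
      else
        vector [vector [0, 1, 0], vector [0, 0, 0], vector [0, 1, 0]])"

definition rmin :: "network \<Rightarrow> edge \<Rightarrow> 3 \<Rightarrow> real" where
  "rmin G e \<phi> = (if e \<in> net_Eo G \<and> \<phi> = 2 then 1 else 9 / 10)"

definition rmax :: "network \<Rightarrow> edge \<Rightarrow> 3 \<Rightarrow> real" where
  "rmax G e \<phi> = (if e \<in> net_Eo G \<and> \<phi> = 2 then 1 else 11 / 10)"


section \<open>RBOPF\<close>

text \<open>\<open>var_sf\<close> is the Fraktur \<open>s\<close>.\<close>

record rbopf_point =
  var_s :: "nat \<Rightarrow> cvec3"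
  var_sf :: "nat \<Rightarrow> cvec3"
  var_r :: "edge \<Rightarrow> rvec3"
  var_A :: "edge \<Rightarrow> cmat3"
  var_V :: "nat \<Rightarrow> cmat3"
  var_I :: "edge \<Rightarrow> cmat3"
  var_S :: "edge \<Rightarrow> cmat3"
  var_S' :: "edge \<Rightarrow> cmat3"

text \<open>
  The objective and the constraints common to both problems are defined on record schemes, so that
  they apply to MBOPF points as well.
\<close>

definition objective :: "network \<Rightarrow> 'x rbopf_point_scheme \<Rightarrow> real" where
  "objective G x = net_cost G (var_s x 0) (var_sf x) (var_V x) (var_I x)"

definition R0 :: "network \<Rightarrow> 'x rbopf_point_scheme \<Rightarrow> bool" where
  "R0 G x \<longleftrightarrow>
     (\<forall>e \<in> net_Er G.
        var_A x e = cmat (diag_mat (var_r x e) ** svr_D G e + svr_F G e) \<and>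
        (\<forall>\<phi>. rmin G e \<phi> \<le> var_r x e $ \<phi> \<and> var_r x e $ \<phi> \<le> rmax G e \<phi>)) \<and>
     var_sf x \<in> net_Sset G"

definition R1 :: "network \<Rightarrow> 'x rbopf_point_scheme \<Rightarrow> bool" where
  "R1 G x \<longleftrightarrow>
     (\<forall>(n, m) \<in> net_Et G. let Z = net_Z G (n, m); S = var_S x (n, m) in
        var_V x m = var_V x n + Z ** var_I x (n, m) ** ctranspose Z
                    - (S ** ctranspose Z + Z ** ctranspose S))"

definition R2 :: "network \<Rightarrow> 'x rbopf_point_scheme \<Rightarrow> bool" where
  "R2 G x \<longleftrightarrow>
     (\<forall>(n, m) \<in> net_Er G.
        var_V x n = var_A x (n, m) ** var_V x m ** ctranspose (var_A x (n, m)))"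

definition R3 :: "network \<Rightarrow> 'x rbopf_point_scheme \<Rightarrow> bool" where
  "R3 G x \<longleftrightarrow>
     (\<forall>e \<in> net_Er G.
        diag_vec (matrix_inv (var_A x e) ** var_S x e ** var_A x e) = diag_vec (var_S' x e))"

definition R4 :: "network \<Rightarrow> 'x rbopf_point_scheme \<Rightarrow> bool" where
  "R4 G x \<longleftrightarrow>
     (\<forall>m \<le> net_N G. var_s x m = var_sf x m - diag_vec (var_V x m ** ctranspose (net_Y G m)))"

definition R5 :: "network \<Rightarrow> 'x rbopf_point_scheme \<Rightarrow> bool" where
  "R5 G x \<longleftrightarrow>
     (\<forall>m \<le> net_N G. var_s x m =
        (\<Sum>k | (m, k) \<in> net_E G. diag_vec (var_S x (m, k)))
      - (\<Sum>n | (n, m) \<in> net_E G \<and> n \<in> svr_primaries G m. diag_vec (var_S' x (n, m)))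
      - (\<Sum>n | (n, m) \<in> net_E G \<and> n \<notin> svr_primaries G m.
           diag_vec (var_S x (n, m) - net_Z G (n, m) ** var_I x (n, m))))"

text \<open>The bounds on the diagonal of \<open>V\<^sub>n\<close> are inequalities between reals, hence \<open>Im = 0\<close>.\<close>

definition R6 :: "network \<Rightarrow> 'x rbopf_point_scheme \<Rightarrow> bool" where
  "R6 G x \<longleftrightarrow>
     var_V x 0 = outer (net_v0 G) \<and>
     (\<forall>n \<le> net_N G. \<forall>\<phi>. let d = diag_vec (var_V x n) $ \<phi> in
        Im d = 0 \<and> (net_vmin G)\<^sup>2 \<le> Re d \<and> Re d \<le> (net_vmax G)\<^sup>2)"

definition edge_block :: "'x rbopf_point_scheme \<Rightarrow> edge \<Rightarrow> complex^(3 + 3)^(3 + 3)" where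
  "edge_block x e =
     block_mat (var_V x (fst e)) (var_S x e) (ctranspose (var_S x e)) (var_I x e)"

definition R7 :: "network \<Rightarrow> 'x rbopf_point_scheme \<Rightarrow> bool" where
  "R7 G x \<longleftrightarrow> (\<forall>e \<in> net_E G. psd (edge_block x e))"

definition R8 :: "network \<Rightarrow> 'x rbopf_point_scheme \<Rightarrow> bool" where
  "R8 G x \<longleftrightarrow> (\<forall>e \<in> net_E G. rank (edge_block x e) = 1)"

definition rbopf_feasible :: "network \<Rightarrow> rbopf_point \<Rightarrow> bool" where
  "rbopf_feasible G x \<longleftrightarrow>
     R0 G x \<and> R1 G x \<and> R2 G x \<and> R3 G x \<and> R4 G x \<and> R5 G x \<and> R6 G x \<and> R7 G x \<and> R8 G x"

text \<open>
  Phase separation, with angles in radians: any phasor \<open>v\<close> with \<open>V\<^sub>m = v v\<^sup>*\<close>, in any polar form, has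
  angle differences in the given interval modulo \<open>2 * pi\<close>. At an RBOPF-feasible point such a \<open>v\<close>
  exists (the edge block has rank one and \<open>A\<close> is invertible), is unique up to a common phase
  factor and has no zero entry, so it is immaterial which \<open>v\<close> and \<open>\<theta>\<close> are taken.
\<close>

definition phase_separated :: "network \<Rightarrow> real \<Rightarrow> 'x rbopf_point_scheme \<Rightarrow> bool" where
  "phase_separated G \<Delta> x \<longleftrightarrow>
     (\<forall>(n, m) \<in> net_Er G. \<forall>(v :: cvec3) (\<theta> :: 3 \<Rightarrow> real).
        var_V x m = outer v \<and> (\<forall>\<phi>. v $ \<phi> = rcis (cmod (v $ \<phi>)) (\<theta> \<phi>)) \<longrightarrow>
        (\<forall>\<phi>. \<exists>k :: int.
           2 * pi / 3 - \<Delta> \<le> \<theta> \<phi> - \<theta> (\<phi> + 1) - 2 * pi * of_int k \<and>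
           \<theta> \<phi> - \<theta> (\<phi> + 1) - 2 * pi * of_int k \<le> 2 * pi / 3 + \<Delta>))"


section \<open>Bounds\<close>

definition Umin :: "network \<Rightarrow> real \<Rightarrow> rmat3" where
  "Umin G \<Delta> = (\<chi> i j.
     if i = j then (net_vmin G)\<^sup>2 else (net_vmax G)\<^sup>2 * cos (2 * pi / 3 + \<Delta>))"

definition Umax :: "network \<Rightarrow> real \<Rightarrow> rmat3" where
  "Umax G \<Delta> = (\<chi> i j.
     if i = j then (net_vmax G)\<^sup>2 else (net_vmin G)\<^sup>2 * cos (2 * pi / 3 - \<Delta>))"

definition Wmin :: "network \<Rightarrow> real \<Rightarrow> rmat3" where
  "Wmin G \<Delta> = (\<chi> i j.
     if i = j then 0
     else if j = i + 1 then (net_vmin G)\<^sup>2 * sin (2 * pi / 3 + \<Delta>)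
     else - ((net_vmax G)\<^sup>2 * sin (2 * pi / 3 - \<Delta>)))"

definition Wmax :: "network \<Rightarrow> real \<Rightarrow> rmat3" where
  "Wmax G \<Delta> = (\<chi> i j.
     if i = j then 0
     else if j = i + 1 then (net_vmax G)\<^sup>2 * sin (2 * pi / 3 - \<Delta>)
     else - ((net_vmin G)\<^sup>2 * sin (2 * pi / 3 + \<Delta>)))"

definition pos_part :: "real \<Rightarrow> real" where "pos_part t = max t 0"
definition neg_part :: "real \<Rightarrow> real" where "neg_part t = max (- t) 0"

text \<open>
  Coefficients of the \<open>(\<psi>, \<psi>')\<close> entry of \<open>P M Q\<^sup>T\<close> in the independent entries of a symmetric
  (\<open>alpha_coeff\<close>, \<open>beta_coeff\<close>) or antisymmetric (\<open>gamma_coeff\<close>) matrix \<open>M\<close>. The two lemmas below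
  state that they are the unique coefficients of such a representation.
\<close>

definition alpha_coeff :: "rmat3 \<Rightarrow> rmat3 \<Rightarrow> 3 \<Rightarrow> 3 \<Rightarrow> 3 \<Rightarrow> real" where
  "alpha_coeff P Q \<psi> \<psi>' \<phi> = P $ \<psi> $ \<phi> * Q $ \<psi>' $ \<phi>"

definition beta_coeff :: "rmat3 \<Rightarrow> rmat3 \<Rightarrow> 3 \<Rightarrow> 3 \<Rightarrow> 3 \<Rightarrow> real" where
  "beta_coeff P Q \<psi> \<psi>' \<phi> =
     P $ \<psi> $ \<phi> * Q $ \<psi>' $ (\<phi> + 1) + P $ \<psi> $ (\<phi> + 1) * Q $ \<psi>' $ \<phi>"

definition gamma_coeff :: "rmat3 \<Rightarrow> rmat3 \<Rightarrow> 3 \<Rightarrow> 3 \<Rightarrow> 3 \<Rightarrow> real" where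
  "gamma_coeff P Q \<psi> \<psi>' \<phi> =
     P $ \<psi> $ \<phi> * Q $ \<psi>' $ (\<phi> + 1) - P $ \<psi> $ (\<phi> + 1) * Q $ \<psi>' $ \<phi>"

lemma phase_wrap: "(4::3) = 1"
  by simp

lemma entry_PMQ:
  fixes P Q M :: rmat3
  shows "(P ** M ** transpose Q) $ \<psi> $ \<psi>' = (\<Sum>i\<in>UNIV. \<Sum>j\<in>UNIV. P $ \<psi> $ i * M $ i $ j * Q $ \<psi>' $ j)"
  by (simp add: matrix_matrix_mult_def transpose_def sum_distrib_right) (rule sum.swap)

lemma alpha_beta_coeff_unique:
  fixes P Q :: rmat3 and \<alpha> \<beta> :: "3 \<Rightarrow> real"
  shows "(\<forall>U. transpose U = U \<longrightarrow>
            (P ** U ** transpose Q) $ \<psi> $ \<psi>' =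
            (\<Sum>\<phi>\<in>UNIV. \<alpha> \<phi> * U $ \<phi> $ \<phi>) + (\<Sum>\<phi>\<in>UNIV. \<beta> \<phi> * U $ \<phi> $ (\<phi> + 1)))
         \<longleftrightarrow> \<alpha> = alpha_coeff P Q \<psi> \<psi>' \<and> \<beta> = beta_coeff P Q \<psi> \<psi>'"
    (is "?L \<longleftrightarrow> ?R")
proof
  assume L: ?L
  define E :: "3 \<Rightarrow> 3 \<Rightarrow> rmat3" where
    "E p q = (\<chi> i j. if i = p \<and> j = q \<or> i = q \<and> j = p then 1 else 0)" for p q
  have "transpose (E p q) = E p q" for p q
    by (auto simp: E_def transpose_def vec_eq_iff)
  with L have *: "(P ** E p q ** transpose Q) $ \<psi> $ \<psi>' =
      (\<Sum>\<phi>\<in>UNIV. \<alpha> \<phi> * E p q $ \<phi> $ \<phi>) + (\<Sum>\<phi>\<in>UNIV. \<beta> \<phi> * E p q $ \<phi> $ (\<phi> + 1))" for p q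
    by blast
  show ?R
    using *[of 1 1] *[of 2 2] *[of 3 3] *[of 1 2] *[of 2 3] *[of 3 1]
    by (simp add: phase_wrap entry_PMQ sum_3 E_def fun_eq_iff forall_3 alpha_coeff_def beta_coeff_def)
next
  assume R: ?R
  show ?L
  proof (intro allI impI)
    fix U :: rmat3 assume "transpose U = U"
    then have "U $ j $ i = U $ i $ j" for i j
      by (simp add: transpose_def vec_eq_iff)
    from this[of 1 2] this[of 2 3] this[of 1 3]
    show "(P ** U ** transpose Q) $ \<psi> $ \<psi>' =
        (\<Sum>\<phi>\<in>UNIV. \<alpha> \<phi> * U $ \<phi> $ \<phi>) + (\<Sum>\<phi>\<in>UNIV. \<beta> \<phi> * U $ \<phi> $ (\<phi> + 1))"
      by (simp add: R phase_wrap entry_PMQ sum_3 alpha_coeff_def beta_coeff_def algebra_simps)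
  qed
qed

lemma gamma_coeff_unique:
  fixes P Q :: rmat3 and \<gamma> :: "3 \<Rightarrow> real"
  shows "(\<forall>W. transpose W = - W \<longrightarrow>
            (P ** W ** transpose Q) $ \<psi> $ \<psi>' = (\<Sum>\<phi>\<in>UNIV. \<gamma> \<phi> * W $ \<phi> $ (\<phi> + 1)))
         \<longleftrightarrow> \<gamma> = gamma_coeff P Q \<psi> \<psi>'"
    (is "?L \<longleftrightarrow> ?R")
proof
  assume L: ?L
  define E :: "3 \<Rightarrow> 3 \<Rightarrow> rmat3" where
    "E p q = (\<chi> i j. (if i = p \<and> j = q then 1 else 0) - (if i = q \<and> j = p then 1 else 0))" for p q
  have "transpose (E p q) = - E p q" for p q
    by (simp add: E_def transpose_def vec_eq_iff conj_commute)
  with L have *: "(P ** E p q ** transpose Q) $ \<psi> $ \<psi>' =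
      (\<Sum>\<phi>\<in>UNIV. \<gamma> \<phi> * E p q $ \<phi> $ (\<phi> + 1))" for p q
    by blast
  show ?R
    using *[of 1 2] *[of 2 3] *[of 3 1]
    by (simp add: phase_wrap entry_PMQ sum_3 E_def fun_eq_iff forall_3 gamma_coeff_def)
next
  assume R: ?R
  show ?L
  proof (intro allI impI)
    fix W :: rmat3 assume W: "transpose W = - W"
    have a: "W $ j $ i = - W $ i $ j" for i j
      using arg_cong[OF W, of "\<lambda>M. M $ i $ j"] unfolding transpose_def by simp
    have "W $ 1 $ 1 = 0" "W $ 2 $ 2 = 0" "W $ 3 $ 3 = 0"
      using a[of 1 1] a[of 2 2] a[of 3 3] by linarith+
    with a[of 1 2] a[of 2 3] a[of 1 3]
    show "(P ** W ** transpose Q) $ \<psi> $ \<psi>' = (\<Sum>\<phi>\<in>UNIV. \<gamma> \<phi> * W $ \<phi> $ (\<phi> + 1))"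
      by (simp add: R phase_wrap entry_PMQ sum_3 gamma_coeff_def algebra_simps)
  qed
qed

text \<open>
  With the arguments \<open>lo hi\<close> in this order these are the lower bounds; with the two interchanged
  they are the upper bounds.
\<close>

definition sym_bound :: "rmat3 \<Rightarrow> rmat3 \<Rightarrow> rmat3 \<Rightarrow> rmat3 \<Rightarrow> rmat3" where
  "sym_bound P Q lo hi = (\<chi> \<psi> \<psi>'. \<Sum>\<phi>\<in>UNIV.
       pos_part (alpha_coeff P Q \<psi> \<psi>' \<phi>) * lo $ \<phi> $ \<phi>
     - neg_part (alpha_coeff P Q \<psi> \<psi>' \<phi>) * hi $ \<phi> $ \<phi>
     + pos_part (beta_coeff P Q \<psi> \<psi>' \<phi>) * lo $ \<phi> $ (\<phi> + 1)
     - neg_part (beta_coeff P Q \<psi> \<psi>' \<phi>) * hi $ \<phi> $ (\<phi> + 1))"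

definition antisym_bound :: "rmat3 \<Rightarrow> rmat3 \<Rightarrow> rmat3 \<Rightarrow> rmat3 \<Rightarrow> rmat3" where
  "antisym_bound P Q lo hi = (\<chi> \<psi> \<psi>'. \<Sum>\<phi>\<in>UNIV.
       pos_part (gamma_coeff P Q \<psi> \<psi>' \<phi>) * lo $ \<phi> $ (\<phi> + 1)
     - neg_part (gamma_coeff P Q \<psi> \<psi>' \<phi>) * hi $ \<phi> $ (\<phi> + 1))"

text \<open>The suffixes \<open>t\<close> and \<open>h\<close> stand for tilde and hat.\<close>

definition Ut_min :: "network \<Rightarrow> real \<Rightarrow> edge \<Rightarrow> rmat3" where
  "Ut_min G \<Delta> e = sym_bound (svr_D G e) (svr_D G e) (Umin G \<Delta>) (Umax G \<Delta>)"

definition Ut_max :: "network \<Rightarrow> real \<Rightarrow> edge \<Rightarrow> rmat3" where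
  "Ut_max G \<Delta> e = sym_bound (svr_D G e) (svr_D G e) (Umax G \<Delta>) (Umin G \<Delta>)"

definition Uh_min :: "network \<Rightarrow> real \<Rightarrow> edge \<Rightarrow> rmat3" where
  "Uh_min G \<Delta> e = sym_bound (svr_D G e) (svr_F G e) (Umin G \<Delta>) (Umax G \<Delta>)"

definition Uh_max :: "network \<Rightarrow> real \<Rightarrow> edge \<Rightarrow> rmat3" where
  "Uh_max G \<Delta> e = sym_bound (svr_D G e) (svr_F G e) (Umax G \<Delta>) (Umin G \<Delta>)"

definition Wt_min :: "network \<Rightarrow> real \<Rightarrow> edge \<Rightarrow> rmat3" where
  "Wt_min G \<Delta> e = antisym_bound (svr_D G e) (svr_D G e) (Wmin G \<Delta>) (Wmax G \<Delta>)"

definition Wt_max :: "network \<Rightarrow> real \<Rightarrow> edge \<Rightarrow> rmat3" where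
  "Wt_max G \<Delta> e = antisym_bound (svr_D G e) (svr_D G e) (Wmax G \<Delta>) (Wmin G \<Delta>)"

definition Wh_min :: "network \<Rightarrow> real \<Rightarrow> edge \<Rightarrow> rmat3" where
  "Wh_min G \<Delta> e = antisym_bound (svr_D G e) (svr_F G e) (Wmin G \<Delta>) (Wmax G \<Delta>)"

definition Wh_max :: "network \<Rightarrow> real \<Rightarrow> edge \<Rightarrow> rmat3" where
  "Wh_max G \<Delta> e = antisym_bound (svr_D G e) (svr_F G e) (Wmax G \<Delta>) (Wmin G \<Delta>)"


section \<open>MBOPF\<close>

definition mccormick :: "real \<Rightarrow> real \<Rightarrow> real \<Rightarrow> real \<Rightarrow> real \<Rightarrow> real \<Rightarrow> real \<Rightarrow> bool" where
  "mccormick u w x u1 u2 w1 w2 \<longleftrightarrow>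
     u1 \<le> u \<and> u \<le> u2 \<and> w1 \<le> w \<and> w \<le> w2 \<and>
     u1 * w + u * w1 - u1 * w1 \<le> x \<and>
     u2 * w + u * w2 - u2 * w2 \<le> x \<and>
     u2 * w + u * w1 - u2 * w1 \<ge> x \<and>
     u1 * w + u * w2 - u1 * w2 \<ge> x"

text \<open>
  \<open>var_UUt\<close>, \<open>var_UUh\<close> are the Fraktur \<open>U\<close> with tilde and hat. The record extends that of RBOPF
  points; \<open>rbopf_point.truncate\<close> forgets the additional variables.
\<close>

record mbopf_point = rbopf_point +
  var_U :: "nat \<Rightarrow> rmat3"
  var_W :: "nat \<Rightarrow> rmat3"
  var_R :: "edge \<Rightarrow> rmat3"
  var_Ut :: "edge \<Rightarrow> rmat3"
  var_Wt :: "edge \<Rightarrow> rmat3"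
  var_Uh :: "edge \<Rightarrow> rmat3"
  var_Wh :: "edge \<Rightarrow> rmat3"
  var_UUt :: "edge \<Rightarrow> rmat3"
  var_Psit :: "edge \<Rightarrow> rmat3"
  var_UUh :: "edge \<Rightarrow> rmat3"
  var_Psih :: "edge \<Rightarrow> rmat3"
  var_X :: "nat \<Rightarrow> 3 \<Rightarrow> nat \<Rightarrow> real"

definition M1 :: "network \<Rightarrow> mbopf_point \<Rightarrow> bool" where
  "M1 G y \<longleftrightarrow>
     (\<forall>e \<in> net_Ey G. diag_vec (var_S y e) = diag_vec (var_S' y e)) \<and>
     (\<forall>e \<in> net_Eo G \<union> net_Ec G. trace (var_S y e) = trace (var_S' y e))"

definition M2 :: "network \<Rightarrow> mbopf_point \<Rightarrow> bool" where
  "M2 G y \<longleftrightarrow>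
     (\<forall>(n, m) \<in> net_Er G.
        var_U y n = map_matrix Re (var_V y n) \<and> var_W y n = map_matrix Im (var_V y n) \<and>
        var_U y m = map_matrix Re (var_V y m) \<and> var_W y m = map_matrix Im (var_V y m))"

definition M3 :: "network \<Rightarrow> mbopf_point \<Rightarrow> bool" where
  "M3 G y \<longleftrightarrow>
     (\<forall>(n, m) \<in> net_Er G. let e = (n, m); D = svr_D G e; F = svr_F G e in
        var_Ut y e = D ** var_U y m ** transpose D \<and>
        var_Wt y e = D ** var_W y m ** transpose D \<and>
        var_Uh y e = D ** var_U y m ** transpose F \<and>
        var_Wh y e = D ** var_W y m ** transpose F)"

definition M4 :: "network \<Rightarrow> mbopf_point \<Rightarrow> bool" where
  "M4 G y \<longleftrightarrow>
     (\<forall>(n, m) \<in> net_Er G. let e = (n, m); F = svr_F G e in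
        var_U y n = var_UUt y e + var_UUh y e + transpose (var_UUh y e)
                    + F ** var_U y m ** transpose F \<and>
        var_W y n = var_Psit y e + var_Psih y e - transpose (var_Psih y e)
                    + F ** var_W y m ** transpose F)"

text \<open>The order on matrices is entrywise.\<close>

definition M5 :: "network \<Rightarrow> real \<Rightarrow> mbopf_point \<Rightarrow> bool" where
  "M5 G \<Delta> y \<longleftrightarrow>
     (\<forall>(n, m) \<in> net_Er G. let e = (n, m) in
        Umin G \<Delta> \<le> var_U y m \<and> var_U y m \<le> Umax G \<Delta> \<and>
        Wmin G \<Delta> \<le> var_W y m \<and> var_W y m \<le> Wmax G \<Delta> \<and>
        Ut_min G \<Delta> e \<le> var_Ut y e \<and> var_Ut y e \<le> Ut_max G \<Delta> e \<and>
        Wt_min G \<Delta> e \<le> var_Wt y e \<and> var_Wt y e \<le> Wt_max G \<Delta> e \<and>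
        Uh_min G \<Delta> e \<le> var_Uh y e \<and> var_Uh y e \<le> Uh_max G \<Delta> e \<and>
        Wh_min G \<Delta> e \<le> var_Wh y e \<and> var_Wh y e \<le> Wh_max G \<Delta> e)"

definition M6 :: "network \<Rightarrow> mbopf_point \<Rightarrow> bool" where
  "M6 G y \<longleftrightarrow>
     (\<forall>e \<in> net_Er G.
        (\<forall>\<phi> \<phi>'. mccormick (var_r y e $ \<phi>) (var_r y e $ \<phi>') (var_R y e $ \<phi> $ \<phi>')
                  (rmin G e \<phi>) (rmax G e \<phi>) (rmin G e \<phi>') (rmax G e \<phi>')) \<and>
        psd (cmat (block_mat (var_R y e)
               (columnvector (var_r y e)) (rowvector (var_r y e)) (mat 1 :: real^1^1))))"

definition M7 :: "network \<Rightarrow> real \<Rightarrow> mbopf_point \<Rightarrow> bool" where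
  "M7 G \<Delta> y \<longleftrightarrow>
     (\<forall>e \<in> net_Er G. \<forall>\<phi>. \<forall>\<phi>' \<in> {\<phi>, \<phi> + 1}.
        mccormick (var_R y e $ \<phi> $ \<phi>') (var_Ut y e $ \<phi> $ \<phi>') (var_UUt y e $ \<phi> $ \<phi>')
          (rmin G e \<phi> * rmin G e \<phi>') (rmax G e \<phi> * rmax G e \<phi>')
          (Ut_min G \<Delta> e $ \<phi> $ \<phi>') (Ut_max G \<Delta> e $ \<phi> $ \<phi>') \<and>
        mccormick (var_R y e $ \<phi> $ \<phi>') (var_Wt y e $ \<phi> $ \<phi>') (var_Psit y e $ \<phi> $ \<phi>')
          (rmin G e \<phi> * rmin G e \<phi>') (rmax G e \<phi> * rmax G e \<phi>')
          (Wt_min G \<Delta> e $ \<phi> $ \<phi>') (Wt_max G \<Delta> e $ \<phi> $ \<phi>'))"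

definition M8 :: "network \<Rightarrow> real \<Rightarrow> mbopf_point \<Rightarrow> bool" where
  "M8 G \<Delta> y \<longleftrightarrow>
     (\<forall>e \<in> net_Er G. \<forall>\<phi> \<phi>'.
        mccormick (var_r y e $ \<phi>) (var_Uh y e $ \<phi> $ \<phi>') (var_UUh y e $ \<phi> $ \<phi>')
          (rmin G e \<phi>) (rmax G e \<phi>) (Uh_min G \<Delta> e $ \<phi> $ \<phi>') (Uh_max G \<Delta> e $ \<phi> $ \<phi>') \<and>
        mccormick (var_r y e $ \<phi>) (var_Wh y e $ \<phi> $ \<phi>') (var_Psih y e $ \<phi> $ \<phi>')
          (rmin G e \<phi>) (rmax G e \<phi>) (Wh_min G \<Delta> e $ \<phi> $ \<phi>') (Wh_max G \<Delta> e $ \<phi> $ \<phi>'))"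

definition M9 :: "network \<Rightarrow> mbopf_point \<Rightarrow> bool" where
  "M9 G y \<longleftrightarrow>
     (\<forall>(n, m) \<in> net_Er G. \<forall>\<phi>. let X = var_X y m \<phi> in
        X 1 - X 2 - X 3 = 0 \<and> X 4 - X 5 - X 6 = 0 \<and> X 7 + X 8 - X 9 = 0)"

definition M10 :: "network \<Rightarrow> real \<Rightarrow> mbopf_point \<Rightarrow> bool" where
  "M10 G \<Delta> y \<longleftrightarrow>
     (\<forall>(n, m) \<in> net_Er G. \<forall>\<phi>.
        let X = var_X y m \<phi>;
            U = var_U y m; U1 = Umin G \<Delta>; U2 = Umax G \<Delta>;
            W = var_W y m; W1 = Wmin G \<Delta>; W2 = Wmax G \<Delta>;
            UU = (\<lambda>i j i' j' x. mccormick (U $ i $ j) (U $ i' $ j') x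
                    (U1 $ i $ j) (U2 $ i $ j) (U1 $ i' $ j') (U2 $ i' $ j'));
            UW = (\<lambda>i j i' j' x. mccormick (U $ i $ j) (W $ i' $ j') x
                    (U1 $ i $ j) (U2 $ i $ j) (W1 $ i' $ j') (W2 $ i' $ j'));
            WW = (\<lambda>i j i' j' x. mccormick (W $ i $ j) (W $ i' $ j') x
                    (W1 $ i $ j) (W2 $ i $ j) (W1 $ i' $ j') (W2 $ i' $ j'));
            \<phi>r = \<phi> + 1;
            \<phi>l = \<phi> - 1
        in UU \<phi> \<phi> \<phi>r \<phi>r (X 1) \<and>
           UU \<phi> \<phi>r \<phi> \<phi>r (X 2) \<and>
           WW \<phi> \<phi>r \<phi> \<phi>r (X 3) \<and>
           UU \<phi>l \<phi> \<phi> \<phi>r (X 4) \<and>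
           WW \<phi>l \<phi> \<phi> \<phi>r (X 5) \<and>
           UU \<phi> \<phi> \<phi>l \<phi>r (X 6) \<and>
           UW \<phi>l \<phi> \<phi> \<phi>r (X 7) \<and>
           UW \<phi> \<phi>r \<phi>l \<phi> (X 8) \<and>
           UW \<phi> \<phi> \<phi>l \<phi>r (X 9))"

definition mbopf_feasible :: "network \<Rightarrow> real \<Rightarrow> mbopf_point \<Rightarrow> bool" where
  "mbopf_feasible G \<Delta> y \<longleftrightarrow>
     R0 G y \<and> R1 G y \<and> R4 G y \<and> R5 G y \<and> R6 G y \<and> R7 G y \<and>
     M1 G y \<and> M2 G y \<and> M3 G y \<and> M4 G y \<and> M5 G \<Delta> y \<and>
     M6 G y \<and> M7 G \<Delta> y \<and> M8 G \<Delta> y \<and> M9 G y \<and> M10 G \<Delta> y"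

end

theory Submission
  imports Defs
begin

text \<open>
  All additional variables are set to the products which they stand for. Since \<open>V\<^sub>n\<close> is a positive
  block of a rank-one matrix and the gain \<open>A\<close> is invertible, \<open>V\<^sub>m = A\<inverse> V\<^sub>n A\<^sup>-\<^sup>*\<close> is the outer product
  of a phasor with itself; its entries satisfy the cycle identities (M9), and by phase separation
  their real and imaginary parts lie in the stated intervals. Bounds on linear images follow by
  interval arithmetic, and the McCormick inequalities hold for every product of bounded factors.
\<close>

section \<open>Interval arithmetic\<close>

text \<open>Each of the four product inequalities of \<open>mccormick\<close> is the expansion of a
  nonnegative product: distance of \<open>u\<close> from one of its bounds times distance of
  \<open>w\<close> from one of its bounds.\<close>

lemma mccormick_product:
  assumes "u1 \<le> u" "u \<le> u2" "w1 \<le> w" "w \<le> w2"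
  shows "mccormick u w (u * w) u1 u2 w1 w2"
proof -
  have "0 \<le> (u - u1) * (w - w1)" "0 \<le> (u2 - u) * (w2 - w)"
    "0 \<le> (u2 - u) * (w - w1)" "0 \<le> (u - u1) * (w2 - w)"
    using assms by simp_all
  with assms show ?thesis
    by (simp add: mccormick_def algebra_simps)
qed

text \<open>According to the sign of \<open>c\<close>, one of \<open>pos_part c\<close> and
  \<open>neg_part c\<close> vanishes and the other is the modulus of \<open>c\<close>; a negative
  \<open>c\<close> swaps the roles of \<open>lo\<close> and \<open>hi\<close>.\<close>

lemma signed_scaling_bounds:
  assumes "lo \<le> t" "t \<le> hi"
  shows "pos_part c * lo - neg_part c * hi \<le> c * t"
    and "c * t \<le> pos_part c * hi - neg_part c * lo"
  using assms
  by (cases "c \<ge> 0"; simp add: pos_part_def neg_part_def max_def mult_left_mono mult_left_mono_neg)+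

text \<open>Interval arithmetic applied term by term to the representation of an entry in the
  independent entries of \<open>U\<close>.\<close>

lemma sym_bound_bounds:
  fixes P Q U lo hi :: rmat3
  assumes "transpose U = U" "lo \<le> U" "U \<le> hi"
  shows "sym_bound P Q lo hi \<le> P ** U ** transpose Q"
    and "P ** U ** transpose Q \<le> sym_bound P Q hi lo"
proof -
  have b: "lo $ i $ j \<le> U $ i $ j" "U $ i $ j \<le> hi $ i $ j" for i j
    using assms by (simp_all add: less_eq_vec_def)
  \<comment> \<open>The uniqueness lemma, instantiated with the coefficients themselves, also yields
    that they represent the entry.\<close>
  have eq: "(P ** U ** transpose Q) $ \<psi> $ \<psi>' =
      (\<Sum>\<phi>\<in>UNIV. alpha_coeff P Q \<psi> \<psi>' \<phi> * U $ \<phi> $ \<phi> + beta_coeff P Q \<psi> \<psi>' \<phi> * U $ \<phi> $ (\<phi> + 1))"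
    for \<psi> \<psi>'
    using alpha_beta_coeff_unique[of P Q \<psi> \<psi>' "alpha_coeff P Q \<psi> \<psi>'" "beta_coeff P Q \<psi> \<psi>'"] assms(1)
    by (simp add: sum.distrib)
  note s = signed_scaling_bounds[OF b]
  show "sym_bound P Q lo hi \<le> P ** U ** transpose Q"
    unfolding less_eq_vec_def eq sym_bound_def vec_lambda_beta
  proof (intro allI sum_mono)
    fix \<psi> \<psi>' \<phi> :: 3
    show "pos_part (alpha_coeff P Q \<psi> \<psi>' \<phi>) * lo $ \<phi> $ \<phi> - neg_part (alpha_coeff P Q \<psi> \<psi>' \<phi>) * hi $ \<phi> $ \<phi>
      + pos_part (beta_coeff P Q \<psi> \<psi>' \<phi>) * lo $ \<phi> $ (\<phi> + 1)
      - neg_part (beta_coeff P Q \<psi> \<psi>' \<phi>) * hi $ \<phi> $ (\<phi> + 1)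
      \<le> alpha_coeff P Q \<psi> \<psi>' \<phi> * U $ \<phi> $ \<phi> + beta_coeff P Q \<psi> \<psi>' \<phi> * U $ \<phi> $ (\<phi> + 1)"
      using s(1)[of "alpha_coeff P Q \<psi> \<psi>' \<phi>" \<phi> \<phi>] s(1)[of "beta_coeff P Q \<psi> \<psi>' \<phi>" \<phi> "\<phi> + 1"]
      by linarith
  qed
  show "P ** U ** transpose Q \<le> sym_bound P Q hi lo"
    unfolding less_eq_vec_def eq sym_bound_def vec_lambda_beta
  proof (intro allI sum_mono)
    fix \<psi> \<psi>' \<phi> :: 3
    show "alpha_coeff P Q \<psi> \<psi>' \<phi> * U $ \<phi> $ \<phi> + beta_coeff P Q \<psi> \<psi>' \<phi> * U $ \<phi> $ (\<phi> + 1)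
      \<le> pos_part (alpha_coeff P Q \<psi> \<psi>' \<phi>) * hi $ \<phi> $ \<phi> - neg_part (alpha_coeff P Q \<psi> \<psi>' \<phi>) * lo $ \<phi> $ \<phi>
      + pos_part (beta_coeff P Q \<psi> \<psi>' \<phi>) * hi $ \<phi> $ (\<phi> + 1)
      - neg_part (beta_coeff P Q \<psi> \<psi>' \<phi>) * lo $ \<phi> $ (\<phi> + 1)"
      using s(2)[of "alpha_coeff P Q \<psi> \<psi>' \<phi>" \<phi> \<phi>] s(2)[of "beta_coeff P Q \<psi> \<psi>' \<phi>" \<phi> "\<phi> + 1"]
      by linarith
  qed
qed

lemma antisym_bound_bounds:
  fixes P Q W lo hi :: rmat3
  assumes "transpose W = - W" "lo \<le> W" "W \<le> hi"
  shows "antisym_bound P Q lo hi \<le> P ** W ** transpose Q"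
    and "P ** W ** transpose Q \<le> antisym_bound P Q hi lo"
proof -
  have b: "lo $ i $ j \<le> W $ i $ j" "W $ i $ j \<le> hi $ i $ j" for i j
    using assms by (simp_all add: less_eq_vec_def)
  have eq: "(P ** W ** transpose Q) $ \<psi> $ \<psi>' =
      (\<Sum>\<phi>\<in>UNIV. gamma_coeff P Q \<psi> \<psi>' \<phi> * W $ \<phi> $ (\<phi> + 1))" for \<psi> \<psi>'
    using gamma_coeff_unique[of P Q \<psi> \<psi>' "gamma_coeff P Q \<psi> \<psi>'"] assms(1) by simp
  show "antisym_bound P Q lo hi \<le> P ** W ** transpose Q"
    and "P ** W ** transpose Q \<le> antisym_bound P Q hi lo"
    unfolding less_eq_vec_def eq antisym_bound_def vec_lambda_beta
    by (intro allI sum_mono signed_scaling_bounds b)+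
qed


section \<open>Complex matrices\<close>

text \<open>The quadratic form of \<open>outer v\<close> at \<open>x\<close> is the squared modulus
  of the inner product of \<open>x\<close> and \<open>v\<close>.\<close>

lemma psd_outer: "psd (outer v)"
proof -
  have "(\<Sum>i\<in>UNIV. \<Sum>j\<in>UNIV. cnj (x $ i) * outer v $ i $ j * x $ j) =
      complex_of_real ((cmod (\<Sum>i\<in>UNIV. cnj (x $ i) * v $ i))\<^sup>2)" for x
    unfolding complex_norm_square cnj_sum sum_product
    by (simp add: outer_def mult_ac)
  then show ?thesis
    by (auto simp: psd_def ctranspose_def outer_def vec_eq_iff)
qed

lemma ctranspose_mult: "ctranspose (A ** B) = ctranspose B ** ctranspose A"
  by (simp add: ctranspose_def matrix_matrix_mult_def vec_eq_iff mult.commute)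

lemma outer_matrix_vector: "outer (B *v w) = B ** outer w ** ctranspose B"
  by (simp add: vec_eq_iff outer_def ctranspose_def matrix_matrix_mult_def matrix_vector_mult_def
      sum_product sum_distrib_left sum_distrib_right mult_ac)

section \<open>Rank-one Hermitian matrices as outer products\<close>

text \<open>The row \<open>M $ k\<close> is nonzero. A row outside its span would form an
  independent pair with it, contradicting row rank one; hence every row is a multiple of
  \<open>M $ k\<close>, and the 2 by 2 minors through the pivot vanish.\<close>

lemma rows_proportional:
  fixes M :: "'a::field^'n^'m"
  assumes "rank M = 1" "M $ k $ l \<noteq> 0"
  shows "M $ i $ j * M $ k $ l = M $ i $ l * M $ k $ j"
proof -
  have nz: "M $ k \<noteq> 0"
    using assms(2) by (auto simp: vec_eq_iff)
  have rows: "M $ a \<in> rows M" for a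
    by (auto simp: rows_def row_def vec_lambda_eta)
  have "M $ i \<in> vec.span {M $ k}"
  proof (rule ccontr)
    assume notin: "M $ i \<notin> vec.span {M $ k}"
    then have "vec.independent {M $ i, M $ k}" and ne: "M $ i \<noteq> M $ k"
      using nz vec.independent_insert[of "M $ i" "{M $ k}"] by (auto intro: vec.span_base)
    then have "card {M $ i, M $ k} \<le> vec.dim (rows M)"
      using vec.independent_card_le_dim[of "{M $ i, M $ k}" "rows M"] rows by auto
    then show False
      using assms(1) ne by (simp add: row_rank_def_gen)
  qed
  then obtain c where "M $ i = c *s M $ k"
    by (auto simp: vec.span_singleton)
  then show ?thesis
    by (simp add: vec_eq_iff)
qed

text \<open>Vanishing minors give \<open>V $ i $ j\<close> as a product of entries of column
  \<open>k\<close> and row \<open>k\<close> divided by the pivot. That row is the conjugate of that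
  column, so column \<open>k\<close> divided by the square root of the pivot is the required
  vector.\<close>

lemma hermitian_block_outer:
  fixes M :: "complex^('n::finite + 'q::finite)^('n + 'q)"
  assumes rank: "rank M = 1" and herm: "ctranspose M = M"
    and pos: "Im (M $ Inl k $ Inl k) = 0" "0 < Re (M $ Inl k $ Inl k)"
    and V: "\<And>i j. M $ Inl i $ Inl j = V $ i $ j"
  shows "\<exists>w. V = outer w"
proof -
  define d where "d = Re (V $ k $ k)"
  have d: "V $ k $ k = complex_of_real d" "d > 0"
    using pos V by (simp_all add: d_def complex_eq_iff)
  have minor: "V $ i $ j * V $ k $ k = V $ i $ k * V $ k $ j" for i j
    using rows_proportional[OF rank, of "Inl k" "Inl k" "Inl i" "Inl j"] d by (simp add: V)
  have h: "cnj (V $ j $ k) = V $ k $ j" for j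
    using herm V by (metis (no_types, lifting) ctranspose_def vec_lambda_beta)
  have sq: "complex_of_real (sqrt d) * complex_of_real (sqrt d) = complex_of_real d"
    using d by (simp flip: of_real_mult)
  have "V = outer (\<chi> i. V $ i $ k / complex_of_real (sqrt d))"
    using minor d by (simp add: vec_eq_iff outer_def h sq field_simps)
  then show ?thesis ..
qed


lemma matrix_inv_mult:
  assumes "invertible A"
  shows "A ** matrix_inv A = mat 1" "matrix_inv A ** A = mat 1"
  using someI_ex[OF assms[unfolded invertible_def]] by (simp_all add: matrix_inv_def)


section \<open>Regulator gains\<close>

text \<open>The determinant of the gain is the product of the three ratios for wye and open delta.
  Closed delta adds the product of the \<open>1 - r\<close>, of modulus at most 0.001, while the
  product of the ratios is at least 0.729.\<close>

lemma svr_gain_invertible: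
  assumes R0: "R0 G x" and e: "e \<in> net_Er G"
  shows "invertible (var_A x e)"
proof -
  let ?r = "var_r x e"
  have A: "var_A x e = cmat (diag_mat ?r ** svr_D G e + svr_F G e)"
    and r: "rmin G e \<phi> \<le> ?r $ \<phi>" "?r $ \<phi> \<le> rmax G e \<phi>" for \<phi>
    using R0 e by (auto simp: R0_def)
  have lo: "9 / 10 \<le> ?r $ \<phi>" and hi: "?r $ \<phi> \<le> 11 / 10" for \<phi>
    using r[of \<phi>] by (auto simp: rmin_def rmax_def split: if_splits)
  have "det (diag_mat ?r ** svr_D G e + svr_F G e) \<noteq> 0"
  proof -
    consider (y) "e \<in> net_Ey G" | (c) "e \<notin> net_Ey G" "e \<in> net_Ec G"
      | (o) "e \<notin> net_Ey G" "e \<notin> net_Ec G" "e \<in> net_Eo G"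
      using e by (auto simp: net_Er_def)
    then show ?thesis
    proof cases
      case y
      then show ?thesis
        using lo[of 1] lo[of 2] lo[of 3]
        by (simp add: svr_D_def svr_F_def det_3 diag_mat_def)
    next
      case c
      have "9/10 * (9/10) * (9/10) \<le> ?r $ 1 * ?r $ 2 * ?r $ 3"
        using lo[of 1] lo[of 2] lo[of 3] by (intro mult_mono) auto
      moreover have "\<bar>(1 - ?r $ 1) * (1 - ?r $ 2) * (1 - ?r $ 3)\<bar> \<le> 1/10 * (1/10) * (1/10)"
      proof -
        have "\<bar>1 - ?r $ \<phi>\<bar> \<le> 1 / 10" for \<phi>
          using lo[of \<phi>] hi[of \<phi>] by linarith
        then show ?thesis
          unfolding abs_mult by (intro mult_mono) auto
      qed
      moreover have "det (diag_mat ?r ** svr_D G e + svr_F G e) =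
          ?r $ 1 * ?r $ 2 * ?r $ 3 + (1 - ?r $ 1) * (1 - ?r $ 2) * (1 - ?r $ 3)"
        using c by (simp add: svr_D_def svr_F_def det_3 diag_mat_def matrix_matrix_mult_def sum_3
            algebra_simps)
      ultimately show ?thesis
        by linarith
    next
      case o
      then show ?thesis
        using lo[of 1] lo[of 2] lo[of 3]
        by (simp add: svr_D_def svr_F_def det_3 diag_mat_def matrix_matrix_mult_def sum_3)
    qed
  qed
  moreover have "det (var_A x e) = complex_of_real (det (diag_mat ?r ** svr_D G e + svr_F G e))"
    unfolding A by (simp add: det_3 map_matrix_def)
  ultimately show ?thesis
    by (simp add: invertible_det_nz)
qed

text \<open>(R3) is a similarity: it preserves the trace in all cases, and for wye the gain is
  diagonal, so that it preserves each diagonal entry.\<close>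

lemma svr_power_transfer:
  assumes R0: "R0 G x" and R3: "R3 G x"
  shows "e \<in> net_Ey G \<Longrightarrow> diag_vec (var_S x e) = diag_vec (var_S' x e)"
    and "e \<in> net_Er G \<Longrightarrow> trace (var_S x e) = trace (var_S' x e)"
proof -
  have diag: "diag_vec (matrix_inv (var_A x e) ** var_S x e ** var_A x e) = diag_vec (var_S' x e)"
    if "e \<in> net_Er G"
    using R3 that by (auto simp: R3_def)
  show "trace (var_S x e) = trace (var_S' x e)" if e: "e \<in> net_Er G"
  proof -
    have "trace (var_S' x e) = trace (matrix_inv (var_A x e) ** (var_S x e ** var_A x e))"
      using diag[OF e] by (simp add: trace_def diag_vec_def vec_eq_iff matrix_mul_assoc)
    also have "\<dots> = trace (var_S x e ** (var_A x e ** matrix_inv (var_A x e)))"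
      by (subst trace_mul_sym) (simp add: matrix_mul_assoc)
    finally show ?thesis
      using svr_gain_invertible[OF R0 e] by (simp add: matrix_inv_mult)
  qed
  show "diag_vec (var_S x e) = diag_vec (var_S' x e)" if y: "e \<in> net_Ey G"
  proof -
    have e: "e \<in> net_Er G"
      using y by (simp add: net_Er_def)
    let ?A = "var_A x e" and ?B = "matrix_inv (var_A x e)"
    have inv: "?B ** ?A = mat 1"
      using svr_gain_invertible[OF R0 e] by (simp add: matrix_inv_mult)
    have A: "?A $ i $ j = (if i = j then complex_of_real (var_r x e $ i) else 0)" for i j
      using R0 e y by (auto simp: R0_def svr_D_def svr_F_def diag_mat_def map_matrix_def)
    have B: "?B $ i $ j * ?A $ j $ j = (if i = j then 1 else 0)" for i j
      using arg_cong[OF inv, of "\<lambda>M. M $ i $ j"]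
      by (simp add: matrix_matrix_mult_def mat_def A if_distrib cong: if_cong)
    \<comment> \<open>The diagonal case of \<open>B\<close> shows that \<open>?A $ j $ j\<close> is
      nonzero, so the off-diagonal case forces the inverse to be diagonal too.\<close>
    have B0: "?B $ i $ j = 0" if "i \<noteq> j" for i j
      using B[of i j] B[of j j] that by auto
    have "(?B ** var_S x e ** ?A) $ i $ i = var_S x e $ i $ i" for i
    proof -
      have "(?B ** var_S x e ** ?A) $ i $ i = (\<Sum>k\<in>UNIV. ?B $ i $ k * var_S x e $ k $ i) * ?A $ i $ i"
        by (simp add: matrix_matrix_mult_def A if_distrib cong: if_cong)
      also have "(\<Sum>k\<in>UNIV. ?B $ i $ k * var_S x e $ k $ i) = ?B $ i $ i * var_S x e $ i $ i"
        by (subst sum.remove[of _ i]) (auto simp: B0 intro!: sum.neutral)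
      also have "\<dots> * ?A $ i $ i = var_S x e $ i $ i"
        using B[of i i] by (simp add: mult_ac)
      finally show ?thesis .
    qed
    with diag[OF e] show ?thesis
      by (simp add: diag_vec_def vec_eq_iff)
  qed
qed


section \<open>Secondary voltages\<close>

text \<open>The edge block contains the primary voltage only. A phasor is therefore found at
  \<open>n\<close> first and then carried to \<open>m\<close> by the inverse gain; its magnitudes
  are bounded by (R6) at \<open>m\<close>.\<close>

lemma svr_secondary_phasor:
  assumes wf: "wf_network G" and feas: "rbopf_feasible G x" and e: "(n, m) \<in> net_Er G"
  obtains v where "var_V x m = outer v"
    and "\<And>\<phi>. net_vmin G \<le> cmod (v $ \<phi>)" "\<And>\<phi>. cmod (v $ \<phi>) \<le> net_vmax G"
proof -
  let ?A = "var_A x (n, m)" and ?M = "edge_block x (n, m)"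
  have vmin: "0 < net_vmin G" and vmax: "0 \<le> net_vmax G" and nm: "n \<le> net_N G" "m \<le> net_N G"
    and eE: "(n, m) \<in> net_E G"
    using wf e by (auto simp: wf_network_def net_E_def)
  have bounds: "Im (var_V x k $ \<phi> $ \<phi>) = 0" "(net_vmin G)\<^sup>2 \<le> Re (var_V x k $ \<phi> $ \<phi>)"
    "Re (var_V x k $ \<phi> $ \<phi>) \<le> (net_vmax G)\<^sup>2" if "k \<le> net_N G" for k \<phi>
    using feas that by (auto simp: rbopf_feasible_def R6_def Let_def diag_vec_def)
  have block: "?M $ Inl i $ Inl j = var_V x n $ i $ j" for i j
    by (simp add: edge_block_def block_mat_def)
  have "rank ?M = 1" "ctranspose ?M = ?M"
    using feas eE by (auto simp: rbopf_feasible_def R7_def R8_def psd_def)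
  \<comment> \<open>The positive lower voltage bound makes this diagonal entry a valid pivot; phase
    1 is an arbitrary choice.\<close>
  moreover have "0 < Re (?M $ Inl 1 $ Inl 1)"
    using bounds(2)[OF nm(1), of 1] vmin by (simp add: block less_le_trans[of 0 "(net_vmin G)\<^sup>2"])
  ultimately obtain w where w: "var_V x n = outer w"
    using hermitian_block_outer[of ?M 1 "var_V x n"] bounds(1)[OF nm(1)] block by auto
  have "R0 G x" and R2: "var_V x n = ?A ** var_V x m ** ctranspose ?A"
    using feas e by (auto simp: rbopf_feasible_def R2_def)
  have inv: "matrix_inv ?A ** ?A = mat 1"
    using svr_gain_invertible[OF \<open>R0 G x\<close> e] by (rule matrix_inv_mult)
  then have inv': "ctranspose ?A ** ctranspose (matrix_inv ?A) = mat 1"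
    by (simp flip: ctranspose_mult) (simp add: ctranspose_def mat_def vec_eq_iff)
  define v where "v = matrix_inv ?A *v w"
  have "outer v = matrix_inv ?A ** (?A ** var_V x m ** ctranspose ?A) ** ctranspose (matrix_inv ?A)"
    by (simp add: v_def outer_matrix_vector flip: w R2)
  also have "\<dots> = (matrix_inv ?A ** ?A) ** var_V x m ** (ctranspose ?A ** ctranspose (matrix_inv ?A))"
    by (simp add: matrix_mul_assoc)
  finally have V: "var_V x m = outer v"
    by (simp add: inv inv')
  then have "var_V x m $ \<phi> $ \<phi> = complex_of_real ((cmod (v $ \<phi>))\<^sup>2)" for \<phi>
    by (simp add: outer_def complex_norm_square del: of_real_power)
  then have "(net_vmin G)\<^sup>2 \<le> (cmod (v $ \<phi>))\<^sup>2" "(cmod (v $ \<phi>))\<^sup>2 \<le> (net_vmax G)\<^sup>2" for \<phi>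
    using bounds(2,3)[OF nm(2), of \<phi>] by simp_all
  then have "net_vmin G \<le> cmod (v $ \<phi>)" "cmod (v $ \<phi>) \<le> net_vmax G" for \<phi>
    using vmin vmax by (auto intro: power2_le_imp_le)
  with V that show thesis
    by blast
qed

section \<open>Angle intervals on the three cyclic phases\<close>

lemma phase_cases: "(j::3) = i \<or> j = i + 1 \<or> i = j + 1"
  using exhaust_3[of i] exhaust_3[of j] by auto

lemma phase_succ_neq: "(i::3) + 1 \<noteq> i" "i + 1 + 1 \<noteq> i"
  using exhaust_3[of i] by auto

text \<open>All angles lie between \<open>pi / 2\<close> and \<open>pi\<close>, where cosine and
  sine both decrease, the cosine is nonpositive and the sine nonnegative. Hence the lower cosine
  bound pairs with the largest modulus \<open>q\<close>, whereas the lower sine bound pairs with the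
  smallest modulus \<open>p\<close>.\<close>

lemma adjacent_phase_bounds:
  assumes \<Delta>: "0 < \<Delta>" "pi / 2 \<le> 2 * pi / 3 - \<Delta>" "2 * pi / 3 + \<Delta> \<le> pi"
    and t: "2 * pi / 3 - \<Delta> \<le> t" "t \<le> 2 * pi / 3 + \<Delta>"
    and a: "p \<le> a" "a \<le> q" "0 \<le> p"
  shows "q * cos (2 * pi / 3 + \<Delta>) \<le> a * cos t" "a * cos t \<le> p * cos (2 * pi / 3 - \<Delta>)"
    and "p * sin (2 * pi / 3 + \<Delta>) \<le> a * sin t" "a * sin t \<le> q * sin (2 * pi / 3 - \<Delta>)"
proof -
  have nonpos: "cos s \<le> 0" and nonneg: "0 \<le> sin s" if "pi / 2 \<le> s" "s \<le> pi" for s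
    using that cos_monotone_0_pi_le[of "pi / 2" s] sin_ge_zero[of s] by auto
  have cos: "cos (2 * pi / 3 + \<Delta>) \<le> cos t" "cos t \<le> cos (2 * pi / 3 - \<Delta>)"
    using \<Delta> t pi_gt_zero by (auto intro!: cos_monotone_0_pi_le)
  \<comment> \<open>The reflection of \<open>s\<close> to \<open>pi - s\<close> reduces this to
    monotonicity of the sine below \<open>pi / 2\<close>.\<close>
  have sin_antimono: "sin s' \<le> sin s" if "pi / 2 \<le> s" "s \<le> s'" "s' \<le> pi" for s s'
    using that sin_monotone_2pi_le[of "pi - s'" "pi - s"] by simp
  have sin: "sin (2 * pi / 3 + \<Delta>) \<le> sin t" "sin t \<le> sin (2 * pi / 3 - \<Delta>)"
    by (rule sin_antimono; use \<Delta> t in linarith)+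
  have "q * cos (2 * pi / 3 + \<Delta>) \<le> a * cos (2 * pi / 3 + \<Delta>)"
    using a nonpos[of "2 * pi / 3 + \<Delta>"] \<Delta> by (intro mult_right_mono_neg) auto
  also have "\<dots> \<le> a * cos t"
    using cos a by (intro mult_left_mono) auto
  finally show "q * cos (2 * pi / 3 + \<Delta>) \<le> a * cos t" .
  have "a * cos t \<le> a * cos (2 * pi / 3 - \<Delta>)"
    using cos a by (intro mult_left_mono) auto
  also have "\<dots> \<le> p * cos (2 * pi / 3 - \<Delta>)"
    using a nonpos[of "2 * pi / 3 - \<Delta>"] \<Delta> by (intro mult_right_mono_neg) auto
  finally show "a * cos t \<le> p * cos (2 * pi / 3 - \<Delta>)" .
  show "p * sin (2 * pi / 3 + \<Delta>) \<le> a * sin t" "a * sin t \<le> q * sin (2 * pi / 3 - \<Delta>)"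
    using sin a \<Delta> nonneg[of "2 * pi / 3 + \<Delta>"] nonneg[of t] t by (auto intro!: mult_mono)
qed

lemma svr_secondary_bounds:
  assumes wf: "wf_network G"
    and \<Delta>: "0 < \<Delta>" "pi / 2 \<le> 2 * pi / 3 - \<Delta>" "2 * pi / 3 + \<Delta> \<le> pi"
    and feas: "rbopf_feasible G x" and sep: "phase_separated G \<Delta> x" and e: "(n, m) \<in> net_Er G"
  shows "Umin G \<Delta> \<le> map_matrix Re (var_V x m)" "map_matrix Re (var_V x m) \<le> Umax G \<Delta>"
    and "Wmin G \<Delta> \<le> map_matrix Im (var_V x m)" "map_matrix Im (var_V x m) \<le> Wmax G \<Delta>"
proof -
  let ?p = "(net_vmin G)\<^sup>2" and ?q = "(net_vmax G)\<^sup>2"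
  obtain v where V: "var_V x m = outer v"
    and lo: "\<And>\<phi>. net_vmin G \<le> cmod (v $ \<phi>)" and hi: "\<And>\<phi>. cmod (v $ \<phi>) \<le> net_vmax G"
    using svr_secondary_phasor[OF wf feas e] by blast
  have vmin: "0 < net_vmin G" "0 \<le> net_vmax G"
    using wf by (auto simp: wf_network_def)
  \<comment> \<open>\<open>phase_separated\<close> speaks of every polar form, so the principal
    argument may be taken.\<close>
  define \<theta> where "\<theta> \<phi> = Arg (v $ \<phi>)" for \<phi>
  have polar: "v $ \<phi> = rcis (cmod (v $ \<phi>)) (\<theta> \<phi>)" for \<phi>
    by (simp add: \<theta>_def rcis_cmod_Arg)
  have entry: "var_V x m $ i $ j = rcis (cmod (v $ i) * cmod (v $ j)) (\<theta> i - \<theta> j)" for i j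
    unfolding V outer_def vec_lambda_beta
    \<comment> \<open>The right side of \<open>polar\<close> contains its left side again, so it
      would loop as a simp rule; just the two entries of \<open>v\<close> are rewritten.\<close>
    by (subst (1 2) polar) (simp add: rcis_def cis_cnj cis_divide[symmetric] cis_inverse divide_inverse)
  have mod: "?p \<le> cmod (v $ i) * cmod (v $ j)" "cmod (v $ i) * cmod (v $ j) \<le> ?q" for i j
    using lo[of i] lo[of j] hi[of i] hi[of j] vmin unfolding power2_eq_square
    by (auto intro!: mult_mono)
  have adj: "?q * cos (2 * pi / 3 + \<Delta>) \<le> Re (var_V x m $ i $ (i + 1))"
      "Re (var_V x m $ i $ (i + 1)) \<le> ?p * cos (2 * pi / 3 - \<Delta>)"
      "?p * sin (2 * pi / 3 + \<Delta>) \<le> Im (var_V x m $ i $ (i + 1))"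
      "Im (var_V x m $ i $ (i + 1)) \<le> ?q * sin (2 * pi / 3 - \<Delta>)" for i
  proof -
    obtain k :: int where
      k: "2 * pi / 3 - \<Delta> \<le> \<theta> i - \<theta> (i + 1) - 2 * pi * of_int k"
         "\<theta> i - \<theta> (i + 1) - 2 * pi * of_int k \<le> 2 * pi / 3 + \<Delta>"
      using sep e V polar unfolding phase_separated_def by blast
    let ?t = "\<theta> i - \<theta> (i + 1) - 2 * pi * of_int k"
    \<comment> \<open>The difference of principal arguments may miss the interval by
      \<open>k\<close> full turns, which cosine and sine do not see.\<close>
    have "cos (\<theta> i - \<theta> (i + 1)) = cos ?t" "sin (\<theta> i - \<theta> (i + 1)) = sin ?t"
      by (simp_all add: cos_diff[of _ "2 * pi * of_int k"] sin_diff[of _ "2 * pi * of_int k"]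
          cos_int_2pin sin_int_2pin)
    then have "Re (var_V x m $ i $ (i + 1)) = cmod (v $ i) * cmod (v $ (i + 1)) * cos ?t"
      "Im (var_V x m $ i $ (i + 1)) = cmod (v $ i) * cmod (v $ (i + 1)) * sin ?t"
      by (simp_all add: entry)
    with adjacent_phase_bounds[OF \<Delta> k mod[of i "i + 1"]]
    show "?q * cos (2 * pi / 3 + \<Delta>) \<le> Re (var_V x m $ i $ (i + 1))"
      "Re (var_V x m $ i $ (i + 1)) \<le> ?p * cos (2 * pi / 3 - \<Delta>)"
      "?p * sin (2 * pi / 3 + \<Delta>) \<le> Im (var_V x m $ i $ (i + 1))"
      "Im (var_V x m $ i $ (i + 1)) \<le> ?q * sin (2 * pi / 3 - \<Delta>)"
      by simp_all
  qed
  have diag: "Re (var_V x m $ i $ i) = cmod (v $ i) * cmod (v $ i)" "Im (var_V x m $ i $ i) = 0" for i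
    by (simp_all add: entry)
  \<comment> \<open>Entries with \<open>i = j + 1\<close> are conjugates of those just bounded; the
    sign change of the imaginary part matches the negated, interchanged bounds in
    \<open>Wmin\<close> and \<open>Wmax\<close>.\<close>
  have swap: "var_V x m $ (i + 1) $ i = cnj (var_V x m $ i $ (i + 1))" for i
    by (simp add: V outer_def mult.commute)
  have "Umin G \<Delta> $ i $ j \<le> Re (var_V x m $ i $ j) \<and> Re (var_V x m $ i $ j) \<le> Umax G \<Delta> $ i $ j \<and>
      Wmin G \<Delta> $ i $ j \<le> Im (var_V x m $ i $ j) \<and> Im (var_V x m $ i $ j) \<le> Wmax G \<Delta> $ i $ j" for i j
  proof -
    consider "j = i" | "j = i + 1" | "i = j + 1"
      using phase_cases by blast
    then show ?thesis
      using mod[of i i] adj[of i] adj[of j]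
      by cases (simp_all add: Umin_def Umax_def Wmin_def Wmax_def diag swap phase_succ_neq
          phase_succ_neq[symmetric])
  qed
  then show "Umin G \<Delta> \<le> map_matrix Re (var_V x m)" "map_matrix Re (var_V x m) \<le> Umax G \<Delta>"
    and "Wmin G \<Delta> \<le> map_matrix Im (var_V x m)" "map_matrix Im (var_V x m) \<le> Wmax G \<Delta>"
    by (simp_all add: less_eq_vec_def map_matrix_def)
qed

lemma transpose_Re_outer: "transpose (map_matrix Re (outer v)) = map_matrix Re (outer v)"
  by (simp add: transpose_def map_matrix_def outer_def vec_eq_iff mult.commute)

lemma transpose_Im_outer: "transpose (map_matrix Im (outer v)) = - map_matrix Im (outer v)"
  by (simp add: transpose_def map_matrix_def outer_def vec_eq_iff mult.commute)

text \<open>For \<open>V = outer v\<close>, the first is \<open>V $ i $ i * V $ j $ j\<close> as the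
  squared modulus of \<open>V $ i $ j\<close>. The other two are the real and imaginary parts of
  \<open>V $ h $ i * V $ i $ j = V $ i $ i * V $ h $ j\<close>, whose factor
  \<open>V $ i $ i\<close> is real.\<close>

lemma phasor_cycle_identities:
  fixes v :: "complex^'n"
  defines "U \<equiv> map_matrix Re (outer v)" and "W \<equiv> map_matrix Im (outer v)"
  shows "U $ i $ i * U $ j $ j = U $ i $ j * U $ i $ j + W $ i $ j * W $ i $ j"
    and "U $ h $ i * U $ i $ j = W $ h $ i * W $ i $ j + U $ i $ i * U $ h $ j"
    and "U $ h $ i * W $ i $ j + U $ i $ j * W $ h $ i = U $ i $ i * W $ h $ j"
  unfolding U_def W_def map_matrix_def outer_def by (simp_all add: algebra_simps)


section \<open>The lifted point\<close>

lemma real_congruence_Re_Im: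
  fixes B :: "real^'n^'m" and V :: "complex^'n^'n"
  shows "map_matrix Re (cmat B ** V ** ctranspose (cmat B)) = B ** map_matrix Re V ** transpose B"
    and "map_matrix Im (cmat B ** V ** ctranspose (cmat B)) = B ** map_matrix Im V ** transpose B"
  by (simp_all add: vec_eq_iff map_matrix_def ctranspose_def transpose_def matrix_matrix_mult_def
      Re_sum Im_sum)

text \<open>The scalar \<open>c\<close> is 1 for symmetric and -1 for antisymmetric
  \<open>M\<close>, so one expansion serves both equations of (M4). It turns the cross term starting
  with \<open>F\<close> into \<open>c\<close> times the transpose of the other one.\<close>

lemma svr_congruence_entry:
  fixes D F M :: rmat3
  assumes "transpose M = c *\<^sub>R M"
  shows "((diag_mat r ** D + F) ** M ** transpose (diag_mat r ** D + F)) $ i $ j =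
      r $ i * r $ j * (D ** M ** transpose D) $ i $ j
      + r $ i * (D ** M ** transpose F) $ i $ j
      + c * (r $ j * (D ** M ** transpose F) $ j $ i)
      + (F ** M ** transpose F) $ i $ j"
proof -
  have B: "(diag_mat r ** D) $ a $ b = r $ a * D $ a $ b" for a b
    by (simp add: matrix_matrix_mult_def diag_mat_def if_distrib[of "\<lambda>z. z * _"] cong: if_cong)
  have M: "M $ b $ a = c * M $ a $ b" for a b
    using arg_cong[OF assms, of "\<lambda>N. N $ a $ b"] by (simp add: transpose_def)
  have flip: "c * (D ** M ** transpose F) $ j $ i =
      (\<Sum>a\<in>UNIV. \<Sum>b\<in>UNIV. F $ i $ a * M $ a $ b * D $ j $ b)"
  proof -
    have "c * (D ** M ** transpose F) $ j $ i =
        (\<Sum>b\<in>UNIV. \<Sum>a\<in>UNIV. D $ j $ b * (c * M $ b $ a) * F $ i $ a)"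
      by (simp add: entry_PMQ sum_distrib_left mult_ac)
    also have "\<dots> = (\<Sum>b\<in>UNIV. \<Sum>a\<in>UNIV. F $ i $ a * M $ a $ b * D $ j $ b)"
      by (simp add: M[symmetric] mult_ac)
    also have "\<dots> = (\<Sum>a\<in>UNIV. \<Sum>b\<in>UNIV. F $ i $ a * M $ a $ b * D $ j $ b)"
      by (rule sum.swap)
    finally show ?thesis .
  qed
  have "c * (r $ j * (D ** M ** transpose F) $ j $ i) =
      r $ j * (\<Sum>a\<in>UNIV. \<Sum>b\<in>UNIV. F $ i $ a * M $ a $ b * D $ j $ b)"
    by (simp flip: flip)
  then show ?thesis
    by (simp add: entry_PMQ B algebra_simps sum.distrib sum_distrib_left)
qed

section \<open>The lift and its components\<close>

text \<open>The values of \<open>U\<close>, \<open>W\<close> and \<open>X\<close> depend on the bus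
  alone, so regulators sharing a bus cannot conflict. Lists are indexed from 0, hence
  \<open>k - 1\<close>.\<close>

definition product_lift :: "network \<Rightarrow> rbopf_point \<Rightarrow> mbopf_point" where
  "product_lift G x =
    (let r = var_r x; U = (\<lambda>k. map_matrix Re (var_V x k)); W = (\<lambda>k. map_matrix Im (var_V x k));
         DD = (\<lambda>e M. svr_D G e ** M ** transpose (svr_D G e));
         DF = (\<lambda>e M. svr_D G e ** M ** transpose (svr_F G e))
     in rbopf_point.extend x (mbopf_point.fields
          U
          W
          (\<lambda>e. \<chi> i j. r e $ i * r e $ j)
          (\<lambda>e. DD e (U (snd e)))
          (\<lambda>e. DD e (W (snd e)))
          (\<lambda>e. DF e (U (snd e)))
          (\<lambda>e. DF e (W (snd e)))
          (\<lambda>e. \<chi> i j. r e $ i * r e $ j * DD e (U (snd e)) $ i $ j)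
          (\<lambda>e. \<chi> i j. r e $ i * r e $ j * DD e (W (snd e)) $ i $ j)
          (\<lambda>e. \<chi> i j. r e $ i * DF e (U (snd e)) $ i $ j)
          (\<lambda>e. \<chi> i j. r e $ i * DF e (W (snd e)) $ i $ j)
          (\<lambda>m i k. let u = (\<lambda>i j. U m $ i $ j); w = (\<lambda>i j. W m $ i $ j) in
             [u i i * u (i + 1) (i + 1), u i (i + 1) * u i (i + 1), w i (i + 1) * w i (i + 1),
              u (i - 1) i * u i (i + 1), w (i - 1) i * w i (i + 1), u i i * u (i - 1) (i + 1),
              u (i - 1) i * w i (i + 1), u i (i + 1) * w (i - 1) i, u i i * w (i - 1) (i + 1)]
             ! (k - 1))))"

lemma product_lift_original:
  "rbopf_point.truncate (product_lift G x) = x"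
  "var_s (product_lift G x) = var_s x" "var_sf (product_lift G x) = var_sf x"
  "var_r (product_lift G x) = var_r x" "var_A (product_lift G x) = var_A x"
  "var_V (product_lift G x) = var_V x" "var_I (product_lift G x) = var_I x"
  "var_S (product_lift G x) = var_S x" "var_S' (product_lift G x) = var_S' x"
  by (simp_all add: product_lift_def Let_def rbopf_point.defs mbopf_point.defs)

lemma product_lift_additional:
  "var_U (product_lift G x) k = map_matrix Re (var_V x k)"
  "var_W (product_lift G x) k = map_matrix Im (var_V x k)"
  "var_R (product_lift G x) e = (\<chi> i j. var_r x e $ i * var_r x e $ j)"
  "var_Ut (product_lift G x) e =
     svr_D G e ** map_matrix Re (var_V x (snd e)) ** transpose (svr_D G e)"
  "var_Wt (product_lift G x) e =
     svr_D G e ** map_matrix Im (var_V x (snd e)) ** transpose (svr_D G e)"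
  "var_Uh (product_lift G x) e =
     svr_D G e ** map_matrix Re (var_V x (snd e)) ** transpose (svr_F G e)"
  "var_Wh (product_lift G x) e =
     svr_D G e ** map_matrix Im (var_V x (snd e)) ** transpose (svr_F G e)"
  "var_UUt (product_lift G x) e =
     (\<chi> i j. var_r x e $ i * var_r x e $ j * var_Ut (product_lift G x) e $ i $ j)"
  "var_Psit (product_lift G x) e =
     (\<chi> i j. var_r x e $ i * var_r x e $ j * var_Wt (product_lift G x) e $ i $ j)"
  "var_UUh (product_lift G x) e =
     (\<chi> i j. var_r x e $ i * var_Uh (product_lift G x) e $ i $ j)"
  "var_Psih (product_lift G x) e =
     (\<chi> i j. var_r x e $ i * var_Wh (product_lift G x) e $ i $ j)"
  by (simp_all add: product_lift_def Let_def rbopf_point.defs mbopf_point.defs)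

lemma product_lift_X:
  fixes x :: rbopf_point
  defines "U \<equiv> \<lambda>m. map_matrix Re (var_V x m)" and "W \<equiv> \<lambda>m. map_matrix Im (var_V x m)"
  shows "var_X (product_lift G x) m i 1 = U m $ i $ i * U m $ (i + 1) $ (i + 1)"
    and "var_X (product_lift G x) m i 2 = U m $ i $ (i + 1) * U m $ i $ (i + 1)"
    and "var_X (product_lift G x) m i 3 = W m $ i $ (i + 1) * W m $ i $ (i + 1)"
    and "var_X (product_lift G x) m i 4 = U m $ (i - 1) $ i * U m $ i $ (i + 1)"
    and "var_X (product_lift G x) m i 5 = W m $ (i - 1) $ i * W m $ i $ (i + 1)"
    and "var_X (product_lift G x) m i 6 = U m $ i $ i * U m $ (i - 1) $ (i + 1)"
    and "var_X (product_lift G x) m i 7 = U m $ (i - 1) $ i * W m $ i $ (i + 1)"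
    and "var_X (product_lift G x) m i 8 = U m $ i $ (i + 1) * W m $ (i - 1) $ i"
    and "var_X (product_lift G x) m i 9 = U m $ i $ i * W m $ (i - 1) $ (i + 1)"
  unfolding U_def W_def
  by (simp_all add: product_lift_def Let_def rbopf_point.defs mbopf_point.defs)

text \<open>The bordered matrix is the outer product of the vector \<open>r\<close> extended by an
  entry 1.\<close>

lemma svr_ratio_psd:
  fixes r :: "real^'n"
  shows "psd (cmat (block_mat (\<chi> i j. r $ i * r $ j) (columnvector r) (rowvector r)
    (mat 1 :: real^1^1)))" (is "psd ?M")
proof -
  define z where "z = (\<chi> i. case i of Inl i' \<Rightarrow> complex_of_real (r $ i') | Inr (_ :: 1) \<Rightarrow> 1)"
  have "?M = outer z"
    by (auto simp: z_def outer_def map_matrix_def block_mat_def vec_eq_iff columnvector_def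
        rowvector_def mat_def split: sum.split)
  then show ?thesis
    by (simp add: psd_outer)
qed

section \<open>Verification of the constraints at the lifted point\<close>

theorem proposition5:
  fixes G :: network and \<Delta> :: real and x :: rbopf_point
  assumes "wf_network G"
    and "0 < \<Delta>" and "pi / 2 \<le> 2 * pi / 3 - \<Delta>" and "2 * pi / 3 + \<Delta> \<le> pi"
    and "rbopf_feasible G x"
    and "phase_separated G \<Delta> x"
  shows "\<exists>y :: mbopf_point. rbopf_point.truncate y = x \<and>
           mbopf_feasible G \<Delta> y \<and> objective G y = objective G x"
proof -
  let ?y = "product_lift G x"
  note wf = assms(1) and feas = assms(5)
  note original = product_lift_original and additional = product_lift_additional
  have svr: "transpose (map_matrix Re (var_V x m)) = map_matrix Re (var_V x m)"
      "transpose (map_matrix Im (var_V x m)) = - map_matrix Im (var_V x m)"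
    if "(n, m) \<in> net_Er G" for n m
    using svr_secondary_phasor[OF wf feas that] transpose_Re_outer transpose_Im_outer by metis+
  \<comment> \<open>These constraints mention original variables only, which the lift leaves
    unchanged.\<close>
  have common: "R0 G ?y" "R1 G ?y" "R4 G ?y" "R5 G ?y" "R6 G ?y" "R7 G ?y"
    using feas unfolding rbopf_feasible_def R0_def R1_def R4_def R5_def R6_def R7_def edge_block_def original
    by blast+
  have ratio: "rmin G e \<phi> \<le> var_r x e $ \<phi>" "var_r x e $ \<phi> \<le> rmax G e \<phi>"
    if "e \<in> net_Er G" for e \<phi>
    using feas that by (auto simp: rbopf_feasible_def R0_def)
  have M1: "M1 G ?y"
  proof -
    have "R0 G x" "R3 G x"
      using feas by (simp_all add: rbopf_feasible_def)
    from svr_power_transfer[OF this] show ?thesis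
      by (simp add: M1_def original net_Er_def)
  qed
  have M2: "M2 G ?y" and M3: "M3 G ?y"
    by (auto simp: M2_def M3_def original additional Let_def)
  have M4: "M4 G ?y"
    unfolding M4_def
  proof (clarify, unfold Let_def, intro conjI)
    fix n m assume e: "(n, m) \<in> net_Er G"
    let ?B = "diag_mat (var_r x (n, m)) ** svr_D G (n, m) + svr_F G (n, m)"
    have V: "var_V x n = cmat ?B ** var_V x m ** ctranspose (cmat ?B)"
      using feas e by (auto simp: rbopf_feasible_def R0_def R2_def)
    \<comment> \<open>The factors 1 and -1 are written out to match the premise of
      \<open>svr_congruence_entry\<close>.\<close>
    have sym: "transpose (map_matrix Re (var_V x m)) = 1 *\<^sub>R map_matrix Re (var_V x m)"
      "transpose (map_matrix Im (var_V x m)) = (- 1) *\<^sub>R map_matrix Im (var_V x m)"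
      using svr[OF e] by simp_all
    show "var_U ?y n = var_UUt ?y (n, m) + var_UUh ?y (n, m) + transpose (var_UUh ?y (n, m))
        + svr_F G (n, m) ** var_U ?y m ** transpose (svr_F G (n, m))"
      unfolding additional V real_congruence_Re_Im vec_eq_iff svr_congruence_entry[OF sym(1)]
      by (simp add: transpose_def)
    show "var_W ?y n = var_Psit ?y (n, m) + var_Psih ?y (n, m) - transpose (var_Psih ?y (n, m))
        + svr_F G (n, m) ** var_W ?y m ** transpose (svr_F G (n, m))"
      unfolding additional V real_congruence_Re_Im vec_eq_iff svr_congruence_entry[OF sym(2)]
      by (simp add: transpose_def)
  qed
  have M5: "M5 G \<Delta> ?y"
    unfolding M5_def additional Let_def Ut_min_def Ut_max_def Uh_min_def Uh_max_def
      Wt_min_def Wt_max_def Wh_min_def Wh_max_def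
    using svr_secondary_bounds[OF assms] svr
    by (auto intro!: sym_bound_bounds antisym_bound_bounds)
  have M6: "M6 G ?y"
    using ratio by (auto simp: M6_def original additional svr_ratio_psd intro!: mccormick_product)
  \<comment> \<open>Nonnegative lower bounds allow the ratio bounds to be multiplied, which gives
    the interval for \<open>var_R\<close> in (M7).\<close>
  have pos: "0 \<le> rmin G e \<phi>" for e \<phi>
    by (simp add: rmin_def)
  \<comment> \<open>(M5) read entrywise supplies the intervals for the second factors in (M7) and
    (M8).\<close>
  have bounds: "Ut_min G \<Delta> e $ i $ j \<le> var_Ut ?y e $ i $ j" "var_Ut ?y e $ i $ j \<le> Ut_max G \<Delta> e $ i $ j"
      "Wt_min G \<Delta> e $ i $ j \<le> var_Wt ?y e $ i $ j" "var_Wt ?y e $ i $ j \<le> Wt_max G \<Delta> e $ i $ j"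
      "Uh_min G \<Delta> e $ i $ j \<le> var_Uh ?y e $ i $ j" "var_Uh ?y e $ i $ j \<le> Uh_max G \<Delta> e $ i $ j"
      "Wh_min G \<Delta> e $ i $ j \<le> var_Wh ?y e $ i $ j" "var_Wh ?y e $ i $ j \<le> Wh_max G \<Delta> e $ i $ j"
    if "e \<in> net_Er G" for e i j
    using M5 that by (cases e; force simp: M5_def Let_def less_eq_vec_def)+
  have M7: "M7 G \<Delta> ?y"
    unfolding M7_def
  proof (intro ballI allI)
    fix e i j assume e: "e \<in> net_Er G"
    have R: "rmin G e i * rmin G e j \<le> var_R ?y e $ i $ j"
      "var_R ?y e $ i $ j \<le> rmax G e i * rmax G e j"
      using ratio[OF e, of i] ratio[OF e, of j] pos[of e i] pos[of e j]
      by (auto simp: additional intro!: mult_mono)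
    have "var_UUt ?y e $ i $ j = var_R ?y e $ i $ j * var_Ut ?y e $ i $ j"
      "var_Psit ?y e $ i $ j = var_R ?y e $ i $ j * var_Wt ?y e $ i $ j"
      by (simp_all add: additional)
    with R bounds[OF e]
    show "mccormick (var_R ?y e $ i $ j) (var_Ut ?y e $ i $ j) (var_UUt ?y e $ i $ j)
          (rmin G e i * rmin G e j) (rmax G e i * rmax G e j)
          (Ut_min G \<Delta> e $ i $ j) (Ut_max G \<Delta> e $ i $ j) \<and>
        mccormick (var_R ?y e $ i $ j) (var_Wt ?y e $ i $ j) (var_Psit ?y e $ i $ j)
          (rmin G e i * rmin G e j) (rmax G e i * rmax G e j)
          (Wt_min G \<Delta> e $ i $ j) (Wt_max G \<Delta> e $ i $ j)"
      by (simp add: mccormick_product)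
  qed
  have M8: "M8 G \<Delta> ?y"
    \<comment> \<open>Only the product variables are unfolded: \<open>var_Uh\<close> and
      \<open>var_Wh\<close> stay folded, as in \<open>bounds\<close>.\<close>
    unfolding M8_def original additional(10,11) vec_lambda_beta
    using bounds ratio by (intro ballI allI conjI mccormick_product) auto
  have "M9 G ?y" "M10 G \<Delta> ?y"
  proof -
    have "X 1 - X 2 - X 3 = 0 \<and> X 4 - X 5 - X 6 = 0 \<and> X 7 + X 8 - X 9 = 0"
      if e: "(n, m) \<in> net_Er G" and X: "X = var_X ?y m \<phi>" for n m \<phi> X
    proof -
      obtain v where v: "var_V x m = outer v"
        using svr_secondary_phasor[OF wf feas e] by blast
      show ?thesis
        unfolding X product_lift_X v
        \<comment> \<open>The cycle runs from the left shift over the phase to its right shift,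
          which are the three distinct phases.\<close>
        using phasor_cycle_identities(1)[of v \<phi> "\<phi> + 1"]
          phasor_cycle_identities(2,3)[of v "\<phi> - 1" \<phi> "\<phi> + 1"]
        by simp
    qed
    then show "M9 G ?y"
      by (auto simp: M9_def Let_def)
    have "Umin G \<Delta> $ i $ j \<le> var_U ?y m $ i $ j" "var_U ?y m $ i $ j \<le> Umax G \<Delta> $ i $ j"
      "Wmin G \<Delta> $ i $ j \<le> var_W ?y m $ i $ j" "var_W ?y m $ i $ j \<le> Wmax G \<Delta> $ i $ j"
      if "(n, m) \<in> net_Er G" for n m i j
      using M5 that by (force simp: M5_def Let_def less_eq_vec_def)+
    then show "M10 G \<Delta> ?y"
      unfolding M10_def Let_def product_lift_X additional(1,2)
      by (clarify, intro conjI mccormick_product) blast+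
  qed
  with common M1 M2 M3 M4 M5 M6 M7 M8 have "mbopf_feasible G \<Delta> ?y"
    by (simp add: mbopf_feasible_def)
  moreover have "objective G ?y = objective G x"
    by (simp add: objective_def original)
  ultimately show ?thesis
    using original(1) by blast
qed

end
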